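(* Let $\Gamma=(\Gamma_n)_n$ be a sequence of graphs and consider the problem of testing $\mathcal H_0:\mathsf G\sim\mathcal G(n,q_n)$ versus $\mathcal H_1:\mathsf G\sim\mathcal G_{\Gamma_n}(n,p_n,q_n)$. Assume the dense regime: $\chi^2(p_n\|q_n)=\Theta(1)$ and $\delta_0<p_n-q_n<1-\delta_0$ for some fixed $\delta_0>0$. 1. (Lower bounds) (a) If $\mu(\Gamma_n)\ge\alpha_n\log|v(\Gamma_n)|$ for some $\alpha_n=\Omega(1)$, then there exists a constant $\underline C>0$ (depending on the sequences $(p_n),(q_n),(\alpha_n)$) such that weak detection is impossible if $\mu(\Gamma_n)\le\underline C\log n$. (b) If $\mu(\Gamma_n)=o(\log|v(\Gamma_n)|)$, then for every $\varepsilon>0$, weak detection is impossible if $|e(\Gamma_n)|\vee d_{\max}^2(\Gamma_n)\le n^{1-\varepsilon}$. 2. (Upper bounds) There exists a constant $\overline C>0$ (depending on $(p_n),(q_n)$) such that, for every $\varepsilon>0$, strong detection is possible if $$\mu(\Gamma_n)\ge\overline C\log n\quad\text{or}\quad |e(\Gamma_n)|\ge n^{1+\varepsilon}\quad\text{or}\quad d_{\max}^2(\Gamma_n)\ge n^{1+\varepsilon}.$$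
   Context: For each $n$, $\Gamma_n$ is an arbitrary finite simple undirected graph without isolated vertices, with vertex set $v(\Gamma_n)$, edge set $e(\Gamma_n)$ and $|v(\Gamma_n)|\le n$. $\mathcal S_{\Gamma_n}$ is the set of subgraphs of the complete graph $\mathcal K_n$ on $[n]$ isomorphic to $\Gamma_n$ ("copies"). $0<q_n<1$, $q_n<p_n\le1$. $\mathcal G(n,q)$ is the Erdős–Rényi distribution. $\mathcal G_{\Gamma_n}(n,p_n,q_n)$: draw a uniformly random copy from $\mathcal S_{\Gamma_n}$; conditionally on it, include every edge of $\mathcal K_n$ independently, with probability $p_n$ if it belongs to the copy and $q_n$ otherwise. A test is a (possibly randomized) function $\phi_n(\mathsf G)\in\{0,1\}$; its risk is $\mathsf R_n(\phi_n)=\mathbb P_{\mathcal H_0}(\phi_n=1)+\mathbb P_{\mathcal H_1}(\phi_n=0)$, and $\mathsf R_n^\star=\inf_{\phi_n}\mathsf R_n(\phi_n)$. Strong detection is possible if some sequence of tests has $\limsup_n\mathsf R_n(\phi_n)=0$; weak detection is impossible if $\lim_n\mathsf R_n^\star=1$. $\chi^2(p\|q)=\frac{(p-q)^2}{q(1-q)}$; $d_{\max}$ is the maximum degree; $\mu(\mathsf G)=\max\{|e(\mathsf H)|/|v(\mathsf H)|:\emptyset\ne\mathsf H\subseteq\mathsf G\}$ is the maximum subgraph density; $a\vee b=\max\{a,b\}$. *)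

theory Defs
  imports "HOL-Probability.Probability" "HOL-Library.Landau_Symbols"
begin

(* A graph is a pair of its vertex set and its set of edges, an edge being the two-element
   set of its end points.  As every finite graph is isomorphic to one with vertices in nat,
   and only isomorphism invariants of the planted graph are used, fixing the vertex type
   loses no generality.  It also keeps the constants in the theorem from depending on a type. *)
type_synonym ugraph = "nat set \<times> nat set set"

abbreviation verts :: "ugraph \<Rightarrow> nat set" where
  "verts G \<equiv> fst G"

abbreviation edges :: "ugraph \<Rightarrow> nat set set" where
  "edges G \<equiv> snd G"

definition all_edges :: "nat set \<Rightarrow> nat set set" where
  "all_edges V = {e. e \<subseteq> V \<and> card e = 2}"

definition simple_graph :: "ugraph \<Rightarrow> bool" where
  "simple_graph G \<longleftrightarrow> finite (verts G) \<and> edges G \<subseteq> all_edges (verts G)"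

definition no_isolated_vertices :: "ugraph \<Rightarrow> bool" where
  "no_isolated_vertices G \<longleftrightarrow> (\<forall>v\<in>verts G. \<exists>e\<in>edges G. v \<in> e)"

definition subgraph :: "ugraph \<Rightarrow> ugraph \<Rightarrow> bool" where
  "subgraph H G \<longleftrightarrow> simple_graph H \<and> verts H \<subseteq> verts G \<and> edges H \<subseteq> edges G"

definition isomorphic :: "ugraph \<Rightarrow> ugraph \<Rightarrow> bool" where
  "isomorphic G H \<longleftrightarrow>
     (\<exists>f. bij_betw f (verts G) (verts H) \<and> edges H = (\<lambda>e. f ` e) ` edges G)"

definition complete_graph :: "nat \<Rightarrow> ugraph" where
  "complete_graph n = ({1..n}, all_edges {1..n})"

definition copies :: "nat \<Rightarrow> ugraph \<Rightarrow> ugraph set" where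
  "copies n \<Gamma> = {H. subgraph H (complete_graph n) \<and> isomorphic \<Gamma> H}"

definition degree :: "ugraph \<Rightarrow> nat \<Rightarrow> nat" where
  "degree G v = card {e \<in> edges G. v \<in> e}"

(* meaningful for nonempty finite graphs only *)
definition max_degree :: "ugraph \<Rightarrow> nat" where
  "max_degree G = Max (degree G ` verts G)"

(* meaningful for nonempty finite graphs only *)
definition max_density :: "ugraph \<Rightarrow> real" where
  "max_density G =
     Max {real (card (edges H)) / real (card (verts H)) | H. subgraph H G \<and> verts H \<noteq> {}}"

definition chi2 :: "real \<Rightarrow> real \<Rightarrow> real" where
  "chi2 p q = (p - q)\<^sup>2 / (q * (1 - q))"

(* Law of a random graph on [n], identified with its edge set, in which every edge e of the
   complete graph is present independently with probability w e. *)
definition random_edges :: "nat \<Rightarrow> (nat set \<Rightarrow> real) \<Rightarrow> nat set set pmf" where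
  "random_edges n w =
     map_pmf (\<lambda>f. {e \<in> edges (complete_graph n). f e})
       (Pi_pmf (edges (complete_graph n)) False (\<lambda>e. bernoulli_pmf (w e)))"

definition erdos_renyi :: "nat \<Rightarrow> real \<Rightarrow> nat set set pmf" where
  "erdos_renyi n q = random_edges n (\<lambda>_. q)"

definition planted :: "nat \<Rightarrow> ugraph \<Rightarrow> real \<Rightarrow> real \<Rightarrow> nat set set pmf" where
  "planted n \<Gamma> p q =
     bind_pmf (pmf_of_set (copies n \<Gamma>))
       (\<lambda>H. random_edges n (\<lambda>e. if e \<in> edges H then p else q))"

(* A randomized test returns the law of its output given the observed graph;
   True is the decision for the planted hypothesis. *)
type_synonym test = "nat set set \<Rightarrow> bool pmf"

definition risk :: "nat \<Rightarrow> ugraph \<Rightarrow> real \<Rightarrow> real \<Rightarrow> test \<Rightarrow> real" where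
  "risk n \<Gamma> p q \<phi> =
     measure_pmf.prob (bind_pmf (erdos_renyi n q) \<phi>) {True} +
     measure_pmf.prob (bind_pmf (planted n \<Gamma> p q) \<phi>) {False}"

definition optimal_risk :: "nat \<Rightarrow> ugraph \<Rightarrow> real \<Rightarrow> real \<Rightarrow> real" where
  "optimal_risk n \<Gamma> p q = (INF \<phi>. risk n \<Gamma> p q \<phi>)"

definition strong_detection_possible ::
    "(nat \<Rightarrow> ugraph) \<Rightarrow> (nat \<Rightarrow> real) \<Rightarrow> (nat \<Rightarrow> real) \<Rightarrow> bool" where
  "strong_detection_possible \<Gamma> p q \<longleftrightarrow>
     (\<exists>\<phi>. limsup (\<lambda>n. ereal (risk n (\<Gamma> n) (p n) (q n) (\<phi> n))) = 0)"

definition weak_detection_impossible ::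
    "(nat \<Rightarrow> ugraph) \<Rightarrow> (nat \<Rightarrow> real) \<Rightarrow> (nat \<Rightarrow> real) \<Rightarrow> bool" where
  "weak_detection_impossible \<Gamma> p q \<longleftrightarrow>
     (\<lambda>n. optimal_risk n (\<Gamma> n) (p n) (q n)) \<longlonglongrightarrow> 1"

(* A nonempty graph without isolated vertices has at least two vertices,
   so there is no admissible graph for n < 2. *)
definition planted_sequence :: "(nat \<Rightarrow> ugraph) \<Rightarrow> bool" where
  "planted_sequence \<Gamma> \<longleftrightarrow>
     (\<forall>n\<ge>2. simple_graph (\<Gamma> n) \<and> verts (\<Gamma> n) \<noteq> {} \<and> no_isolated_vertices (\<Gamma> n)
             \<and> card (verts (\<Gamma> n)) \<le> n)"

end

theory Submission
  imports Defs "HOL-Real_Asymp.Real_Asymp"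
begin

text \<open>
  Lower bounds: by Cauchy--Schwarz the risk is at least 1 minus the square root of the
  \<open>\<chi>\<^sup>2\<close>-divergence, and the second moment of the likelihood ratio is the average of
  \<open>(1 + \<chi>\<^sup>2)\<close> to the power \<open>|e(H) \<inter> e(H')|\<close> over two independent copies.  By the definition of
  \<open>\<mu>\<close> this exponent is at most \<open>\<mu>\<close> times the number of vertices of the intersection that matter.
  In case (a) one takes all common vertices, \<open>\<Gamma>\<close> having only \<open>n\<close> to a small power of them.
  In case (b) only the non-isolated vertices of the intersection count; they are dominated by a
  maximal matching, and summing over the possible matchings and their neighbours gives a bound in
  terms of \<open>|e|\<^sup>2 / n\<^sup>2\<close> and \<open>d\<^sub>m\<^sub>a\<^sub>x\<^sup>2 / n\<close>.

  Upper bounds: in all three cases one scans a family of edge sets for an excess of edges.  The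
  family consists of the set of all edges, of the stars, or of the copies of a densest subgraph,
  and Hoeffding's inequality with a union bound controls both errors.
\<close>

section \<open>Exponential moments of sparse random sets\<close>

text \<open>The obstacle in the lower bounds is that the values of a random permutation are
  dependent. Expanding powers of \<open>1 + y\<close> over subsets leaves only containment events,
  and t prescribed values occur with probability at most (2/n)^t as long as a copy occupies at most
  half of [n]. Let k be the number of vertices of \<Gamma> and x the power of 1 + chi-squared with
  exponent \<mu>. Charging x to every common vertex costs about x k^2 / n in the exponent. In case
  (a) the two bounds on \<mu> make both k and x small powers of n, so this vanishes. In case (b) x
  is still a small power of n, but k may exceed the square root of n. A common vertex that lies on
  no common edge must then go uncharged. In the upper bounds, sets of size s with a planted part of
  size m can be told apart once (p - q)^2 m^2 / s dominates the logarithm of the number of sets.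
  Here (m, s) is (|e|, n^2) for all edges and (d_max, n) for stars. For a densest subgraph on v
  vertices m = s = \<mu> v faces about n^v sets, so v cancels and \<mu> is compared with log
  n.\<close>

text \<open>Read from left to right, this turns an exponential moment of a random set into a sum of
  containment events; read from right to left, it sums the resulting bounds up again.\<close>

lemma one_plus_power_card:
  fixes y :: real
  assumes "finite Z"
  shows "(1 + y) ^ card Z = (\<Sum>T\<in>Pow Z. y ^ card T)"
proof -
  have "(1 + y) ^ card Z = (\<Prod>z\<in>Z. y + 1)"
    by (simp add: add.commute)
  also have "\<dots> = (\<Sum>T\<in>Pow Z. (\<Prod>z\<in>T. y) * (\<Prod>z\<in>Z - T. 1))"
    using assms by (rule prod_add)
  finally show ?thesis by simp
qed

lemma one_plus_power_le_exp:
  fixes c :: real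
  assumes "c \<ge> 0"
  shows "(1 + c) ^ m \<le> exp (real m * c)"
proof -
  have "(1 + c) ^ m \<le> exp c ^ m"
    using assms by (intro power_mono) (auto simp: exp_ge_add_one_self)
  then show ?thesis
    by (simp add: exp_of_nat_mult)
qed

text \<open>
  A random set \<open>R\<close>, uniformly distributed over the outcomes in \<open>P\<close>, that contains any given
  finite part of \<open>N\<close> with at most the probability that independent choices would give.
\<close>

locale sparse_random_set =
  fixes P :: "'w set" and R :: "'w \<Rightarrow> 'a set" and N :: "'a set" and \<theta> :: real
  assumes finite_P: "finite P" and finite_N: "finite N" and \<theta>_nonneg: "\<theta> \<ge> 0"
    and contains_le: "T \<subseteq> N \<Longrightarrow> real (card {\<omega> \<in> P. T \<subseteq> R \<omega>}) \<le> \<theta> ^ card T * real (card P)"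
begin

text \<open>Expand the power over the subsets \<open>T\<close> of
  \<open>R \<omega> \<inter> D\<close>, exchange the sums and apply \<open>contains_le\<close> to
  \<open>T0 \<union> T\<close>. Disjointness makes the exponents of \<theta> add up, so the bound is
  the one for independent choices. The forced part \<open>T0\<close> will be the vertex set of a
  matching.\<close>

lemma moment_le:
  assumes T0: "T0 \<subseteq> N" and D: "D \<subseteq> N" and disj: "T0 \<inter> D = {}" and y: "y \<ge> 0"
  shows "(\<Sum>\<omega> | \<omega> \<in> P \<and> T0 \<subseteq> R \<omega>. (1 + y) ^ card (R \<omega> \<inter> D))
           \<le> real (card P) * \<theta> ^ card T0 * (1 + \<theta> * y) ^ card D"
proof -
  have fD: "finite D" and fT0: "finite T0"
    using D T0 finite_N by (auto intro: finite_subset)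
  have "(\<Sum>\<omega> | \<omega> \<in> P \<and> T0 \<subseteq> R \<omega>. (1 + y) ^ card (R \<omega> \<inter> D))
      = (\<Sum>\<omega> | \<omega> \<in> P \<and> T0 \<subseteq> R \<omega>. \<Sum>T | T \<in> Pow D \<and> T \<subseteq> R \<omega>. y ^ card T)"
  proof (intro sum.cong refl)
    fix \<omega>
    have "(1 + y) ^ card (R \<omega> \<inter> D) = (\<Sum>T\<in>Pow (R \<omega> \<inter> D). y ^ card T)"
      using fD by (intro one_plus_power_card) auto
    also have "Pow (R \<omega> \<inter> D) = {T \<in> Pow D. T \<subseteq> R \<omega>}" by auto
    finally show "(1 + y) ^ card (R \<omega> \<inter> D) = (\<Sum>T | T \<in> Pow D \<and> T \<subseteq> R \<omega>. y ^ card T)" .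
  qed
  also have "\<dots> = (\<Sum>T\<in>Pow D. \<Sum>\<omega> | \<omega> \<in> {\<omega> \<in> P. T0 \<subseteq> R \<omega>} \<and> T \<subseteq> R \<omega>. y ^ card T)"
    using finite_P fD by (subst sum.swap_restrict) auto
  also have "\<dots> = (\<Sum>T\<in>Pow D. y ^ card T * real (card {\<omega> \<in> P. T0 \<union> T \<subseteq> R \<omega>}))"
    by (intro sum.cong refl) (simp add: conj_assoc mult.commute)
  also have "\<dots> \<le> (\<Sum>T\<in>Pow D. y ^ card T * (\<theta> ^ card (T0 \<union> T) * real (card P)))"
    using T0 D y by (intro sum_mono mult_left_mono contains_le) auto
  also have "\<dots> = (\<Sum>T\<in>Pow D. real (card P) * \<theta> ^ card T0 * (\<theta> * y) ^ card T)"
  proof (intro sum.cong refl)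
    fix T assume "T \<in> Pow D"
    then have "card (T0 \<union> T) = card T0 + card T"
      using disj fT0 fD by (intro card_Un_disjoint) (auto intro: finite_subset)
    then show "y ^ card T * (\<theta> ^ card (T0 \<union> T) * real (card P))
        = real (card P) * \<theta> ^ card T0 * (\<theta> * y) ^ card T"
      by (simp add: power_add power_mult_distrib)
  qed
  also have "\<dots> = real (card P) * \<theta> ^ card T0 * (1 + \<theta> * y) ^ card D"
    by (simp add: one_plus_power_card[OF fD] sum_distrib_left)
  finally show ?thesis .
qed

text \<open>
  A maximal matching \<open>M\<close> among the edges inside \<open>R\<close> dominates all their end points, so these lie
  in \<open>\<Union>M\<close> together with the part of \<open>R\<close> adjacent to \<open>\<Union>M\<close>. One sums over all candidates for \<open>M\<close>.
\<close>

lemma covered_moment_le: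
  assumes fin: "finite \<E>" and \<E>: "\<And>t. t \<in> \<E> \<Longrightarrow> t \<subseteq> N \<and> card t = 2"
    and deg: "\<And>z. card {z'. {z, z'} \<in> \<E>} \<le> \<Delta>" and x: "x \<ge> 1"
  shows "(\<Sum>\<omega>\<in>P. x ^ card (\<Union>{t \<in> \<E>. t \<subseteq> R \<omega>}))
           \<le> real (card P) * exp (real (card \<E>) * ((x * \<theta>)\<^sup>2 * exp (2 * real \<Delta> * (x * \<theta>))))"
proof -
  define \<M> where "\<M> = {M. M \<subseteq> \<E> \<and> disjoint M}"
  \<comment> \<open>The vertices of \<open>M\<close> are removed so that \<open>moment_le\<close>
    applies with \<open>\<Union>M\<close> as forced part and \<open>nb M\<close> as free
    part.\<close>
  define nb where "nb M = {z'. \<exists>z\<in>\<Union>M. {z, z'} \<in> \<E>} - \<Union>M" for M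
  \<comment> \<open>The price of one matching edge: two points forced into \<open>R\<close>, each
    paying x and \<theta>, and at most \<Delta> neighbours of each, whose joint moment is at most
    the exponential factor.\<close>
  define c where "c = (x * \<theta>)\<^sup>2 * exp (2 * real \<Delta> * (x * \<theta>))"
  have fE: "finite t" if "t \<in> \<E>" for t
    using \<E>[OF that] by (auto intro: card_ge_0_finite)
  have f\<M>: "finite \<M>"
    using fin by (auto simp: \<M>_def)
  have c: "c \<ge> 0" by (simp add: c_def)
  have nb_N: "nb M \<subseteq> N" for M
    using \<E> by (auto simp: nb_def)
  have UM: "\<Union>M \<subseteq> N" "finite (\<Union>M)" "card (\<Union>M) = 2 * card M" if "M \<in> \<M>" for M
  proof -
    have M: "M \<subseteq> \<E>" "disjoint M" using that by (auto simp: \<M>_def)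
    show "\<Union>M \<subseteq> N" using M \<E> by auto
    then show "finite (\<Union>M)" using finite_N by (rule finite_subset)
    have "card (\<Union>M) = (\<Sum>t\<in>M. card t)"
      using M fE by (intro card_Union_disjoint) auto
    also have "\<dots> = (\<Sum>t\<in>M. 2)"
      using M \<E> by (intro sum.cong) auto
    finally show "card (\<Union>M) = 2 * card M" by simp
  qed
  have card_nb: "card (nb M) \<le> 2 * card M * \<Delta>" if "M \<in> \<M>" for M
  proof -
    have fin_adj: "finite {z'. {z, z'} \<in> \<E>}" for z
      by (rule finite_subset[OF _ finite_N]) (use \<E> in auto)
    have "card (nb M) \<le> card (\<Union>z\<in>\<Union>M. {z'. {z, z'} \<in> \<E>})"
      by (rule card_mono[OF finite_UN_I[OF UM(2)[OF that] fin_adj]]) (auto simp: nb_def)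
    also have "\<dots> \<le> (\<Sum>z\<in>\<Union>M. card {z'. {z, z'} \<in> \<E>})"
      using UM(2)[OF that] by (rule card_UN_le)
    also have "\<dots> \<le> (\<Sum>z\<in>\<Union>M. \<Delta>)"
      using deg by (intro sum_mono) auto
    finally show ?thesis using UM(3)[OF that] by simp
  qed
  \<comment> \<open>A maximal matching depends on \<omega>. Bounding its term by the sum over all
    matchings inside \<open>R \<omega>\<close> removes this dependence, so that the sums can be
    exchanged.\<close>
  have cover: "x ^ card (\<Union>{t \<in> \<E>. t \<subseteq> R \<omega>})
      \<le> (\<Sum>M | M \<in> \<M> \<and> \<Union>M \<subseteq> R \<omega>. x ^ (2 * card M) * x ^ card (R \<omega> \<inter> nb M))" for \<omega>
  proof -
    define \<F> where "\<F> = {t \<in> \<E>. t \<subseteq> R \<omega>}"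
    have "finite {M. M \<subseteq> \<F> \<and> disjoint M}" "{M. M \<subseteq> \<F> \<and> disjoint M} \<noteq> {}"
      using fin by (auto simp: \<F>_def disjoint_def)
    from finite_has_maximal[OF this] obtain M where M: "M \<subseteq> \<F>" "disjoint M"
      and maxM: "\<And>M'. M' \<subseteq> \<F> \<Longrightarrow> disjoint M' \<Longrightarrow> M \<subseteq> M' \<Longrightarrow> M = M'"
      by auto
    have M\<M>: "M \<in> \<M>" and MR: "\<Union>M \<subseteq> R \<omega>"
      using M by (auto simp: \<M>_def \<F>_def)
    have meets: "t \<inter> \<Union>M \<noteq> {}" if t: "t \<in> \<F>" for t
    proof
      assume e: "t \<inter> \<Union>M = {}"
      then have "disjoint (insert t M)"
        using M(2) by (auto simp: disjoint_def)
      then have "t \<in> M" using maxM[of "insert t M"] t M(1) by auto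
      then have "t = {}" using e by auto
      then show False using t \<E>[of t] by (auto simp: \<F>_def)
    qed
    have "\<Union>\<F> \<subseteq> \<Union>M \<union> (R \<omega> \<inter> nb M)"
    proof
      fix z assume "z \<in> \<Union>\<F>"
      then obtain t where t: "t \<in> \<F>" "z \<in> t" by auto
      obtain w where w: "w \<in> t" "w \<in> \<Union>M" using meets[OF t(1)] by auto
      show "z \<in> \<Union>M \<union> (R \<omega> \<inter> nb M)"
      proof (cases "z \<in> \<Union>M")
        case False
        then have "z \<noteq> w" using w by auto
        moreover have "card t = 2" using t \<E> by (auto simp: \<F>_def)
        ultimately have "t = {w, z}" using t(2) w(1)
          by (auto simp: card_2_iff)
        then show ?thesis using t w False by (auto simp: nb_def \<F>_def)
      qed simp
    qed
    then have "card (\<Union>\<F>) \<le> card (\<Union>M \<union> (R \<omega> \<inter> nb M))"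
      using UM(2)[OF M\<M>] nb_N[of M] finite_N by (intro card_mono) (auto intro: finite_subset)
    also have "\<dots> \<le> 2 * card M + card (R \<omega> \<inter> nb M)"
      using UM(3)[OF M\<M>] card_Un_le[of "\<Union>M"] by simp
    finally have "x ^ card (\<Union>\<F>) \<le> x ^ (2 * card M + card (R \<omega> \<inter> nb M))"
      using x by (intro power_increasing) auto
    also have "\<dots> = x ^ (2 * card M) * x ^ card (R \<omega> \<inter> nb M)"
      by (simp add: power_add)
    also have "\<dots> \<le> (\<Sum>M | M \<in> \<M> \<and> \<Union>M \<subseteq> R \<omega>. x ^ (2 * card M) * x ^ card (R \<omega> \<inter> nb M))"
      using M\<M> MR f\<M> x
      by (intro member_le_sum[where f = "\<lambda>M. x ^ (2 * card M) * x ^ card (R \<omega> \<inter> nb M)"]) auto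
    finally show ?thesis by (simp add: \<F>_def)
  qed
  have "(\<Sum>\<omega>\<in>P. x ^ card (\<Union>{t \<in> \<E>. t \<subseteq> R \<omega>}))
      \<le> (\<Sum>\<omega>\<in>P. \<Sum>M | M \<in> \<M> \<and> \<Union>M \<subseteq> R \<omega>. x ^ (2 * card M) * x ^ card (R \<omega> \<inter> nb M))"
    by (intro sum_mono cover)
  also have "\<dots> = (\<Sum>M\<in>\<M>. \<Sum>\<omega> | \<omega> \<in> P \<and> \<Union>M \<subseteq> R \<omega>.
                     x ^ (2 * card M) * x ^ card (R \<omega> \<inter> nb M))"
    using finite_P f\<M> by (rule sum.swap_restrict)
  also have "\<dots> \<le> (\<Sum>M\<in>\<M>. real (card P) * c ^ card M)"
  proof (intro sum_mono)
    fix M assume M: "M \<in> \<M>"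
    have "(\<Sum>\<omega> | \<omega> \<in> P \<and> \<Union>M \<subseteq> R \<omega>. x ^ (2 * card M) * x ^ card (R \<omega> \<inter> nb M))
        = x ^ (2 * card M) *
          (\<Sum>\<omega> | \<omega> \<in> P \<and> \<Union>M \<subseteq> R \<omega>. (1 + (x - 1)) ^ card (R \<omega> \<inter> nb M))"
      by (simp add: sum_distrib_left)
    also have "\<dots> \<le> x ^ (2 * card M) *
        (real (card P) * \<theta> ^ card (\<Union>M) * (1 + \<theta> * (x - 1)) ^ card (nb M))"
      using x UM(1)[OF M] nb_N[of M] by (intro mult_left_mono moment_le) (auto simp: nb_def)
    also have "\<dots> \<le> x ^ (2 * card M) *
        (real (card P) * \<theta> ^ card (\<Union>M) * (1 + x * \<theta>) ^ (2 * card M * \<Delta>))"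
    proof (intro mult_left_mono)
      have "(1 + \<theta> * (x - 1)) ^ card (nb M) \<le> (1 + x * \<theta>) ^ card (nb M)"
        using x \<theta>_nonneg mult_left_mono[of 1 x \<theta>] by (intro power_mono) (auto simp: algebra_simps)
      also have "\<dots> \<le> (1 + x * \<theta>) ^ (2 * card M * \<Delta>)"
        using x \<theta>_nonneg card_nb[OF M] by (intro power_increasing) auto
      finally show "(1 + \<theta> * (x - 1)) ^ card (nb M) \<le> (1 + x * \<theta>) ^ (2 * card M * \<Delta>)" .
    qed (use x \<theta>_nonneg in auto)
    also have "\<dots> \<le> x ^ (2 * card M) *
        (real (card P) * \<theta> ^ card (\<Union>M) * exp (real (2 * card M * \<Delta>) * (x * \<theta>)))"
      using x \<theta>_nonneg by (intro mult_left_mono one_plus_power_le_exp) auto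
    also have "exp (real (2 * card M * \<Delta>) * (x * \<theta>)) = exp (2 * real \<Delta> * (x * \<theta>)) ^ card M"
      by (simp flip: exp_of_nat_mult add: mult_ac)
    also have "x ^ (2 * card M) * (real (card P) * \<theta> ^ card (\<Union>M) * exp (2 * real \<Delta> * (x * \<theta>)) ^ card M)
        = real (card P) * c ^ card M"
      using UM(3)[OF M] by (simp add: c_def power_mult_distrib mult_ac flip: power_mult)
    finally show "(\<Sum>\<omega> | \<omega> \<in> P \<and> \<Union>M \<subseteq> R \<omega>. x ^ (2 * card M) * x ^ card (R \<omega> \<inter> nb M))
        \<le> real (card P) * c ^ card M" .
  qed
  \<comment> \<open>Dropping the matching condition only adds nonnegative terms and leaves a
    binomial sum in closed form.\<close>
  also have "\<dots> \<le> (\<Sum>M\<in>Pow \<E>. real (card P) * c ^ card M)"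
    using fin c by (intro sum_mono2) (auto simp: \<M>_def)
  also have "\<dots> = real (card P) * (1 + c) ^ card \<E>"
    by (simp add: one_plus_power_card[OF fin] sum_distrib_left)
  also have "\<dots> \<le> real (card P) * exp (real (card \<E>) * c)"
    using c by (intro mult_left_mono one_plus_power_le_exp) auto
  finally show ?thesis by (simp add: c_def)
qed

end

section \<open>The graph of a random permutation as a sparse random set\<close>

lemma card_permutes_extending_le:
  assumes "finite A"
  shows "card {\<pi>. \<pi> permutes A \<and> T \<subseteq> {(a, \<pi> a) |a. a \<in> B}} \<le> fact (card A - card (A \<inter> fst ` T))"
proof (cases "{\<pi>. \<pi> permutes A \<and> T \<subseteq> {(a, \<pi> a) |a. a \<in> B}} = {}")
  case False
  then obtain \<pi>0 where \<pi>0: "\<pi>0 permutes A" "T \<subseteq> {(a, \<pi>0 a) |a. a \<in> B}" by auto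
  have "inj_on (\<lambda>\<pi>. inv \<pi>0 \<circ> \<pi>) {\<pi>. \<pi> permutes A \<and> T \<subseteq> {(a, \<pi> a) |a. a \<in> B}}"
    by (rule inj_on_inverseI[where g = "\<lambda>\<rho>. \<pi>0 \<circ> \<rho>"]) (simp add: o_assoc permutes_inv_o(1)[OF \<pi>0(1)])
  moreover have "(\<lambda>\<pi>. inv \<pi>0 \<circ> \<pi>) ` {\<pi>. \<pi> permutes A \<and> T \<subseteq> {(a, \<pi> a) |a. a \<in> B}}
      \<subseteq> {\<pi>. \<pi> permutes (A - fst ` T)}"
  proof safe
    fix \<pi> assume \<pi>: "\<pi> permutes A" "T \<subseteq> {(a, \<pi> a) |a. a \<in> B}"
    have perm: "inv \<pi>0 \<circ> \<pi> permutes A"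
      using \<pi> \<pi>0 by (intro permutes_compose permutes_inv)
    have fixp: "(inv \<pi>0 \<circ> \<pi>) a = a" if a: "a \<in> fst ` T" for a
    proof -
      obtain b where b: "(a, b) \<in> T" using a by force
      have "\<pi> a = \<pi>0 a" using b \<pi>(2) \<pi>0(2) by auto
      then show ?thesis by (simp add: permutes_inverses(2)[OF \<pi>0(1)])
    qed
    show "inv \<pi>0 \<circ> \<pi> permutes (A - fst ` T)"
      by (rule permutes_superset[OF perm], rule fixp) blast
  qed
  ultimately have "card {\<pi>. \<pi> permutes A \<and> T \<subseteq> {(a, \<pi> a) |a. a \<in> B}}
      \<le> card {\<pi>. \<pi> permutes (A - fst ` T)}"
    using assms by (intro card_inj_on_le[where f = "\<lambda>\<pi>. inv \<pi>0 \<circ> \<pi>"]) (auto intro: finite_permutations)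
  also have "\<dots> = fact (card A - card (A \<inter> fst ` T))"
    using assms by (simp add: card_permutations[OF refl] card_Diff_subset_Int)
  finally show ?thesis .
qed (simp only: card.empty)

text \<open>Each of the \<open>t\<close> factors by which the factorials differ is at least n/2,
  because \<open>t \<le> k \<le> n/2\<close>. This is the origin of the density 2/n and of the
  condition that a copy has at most n/2 vertices.\<close>

lemma fact_diff_le:
  assumes "2 * k \<le> n" "t \<le> k" "n > 0"
  shows "fact (n - t) \<le> (2 / real n) ^ t * fact n"
  using assms(2)
proof (induction t)
  case (Suc t)
  have "fact (n - t) = real (n - t) * fact (n - Suc t)"
    using Suc.prems assms by (metis Suc_diff_Suc fact_Suc less_le_trans Suc_le_lessD le_trans
      mult_2 le_add1 of_nat_fact of_nat_mult)
  moreover have "real n / 2 \<le> real (n - t)"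
    using Suc.prems assms by (simp add: of_nat_diff)
  ultimately have "real n / 2 * fact (n - Suc t) \<le> fact (n - t)"
    by (simp add: mult_right_mono)
  also have "\<dots> \<le> (2 / real n) ^ t * fact n"
    using Suc by simp
  finally show ?case
    using assms by (simp add: field_simps)
qed simp

lemma sparse_permutation:
  assumes "finite V" "V' \<subseteq> {1..n}" "2 * card V' \<le> n" "n > 0"
  shows "sparse_random_set {\<pi>. \<pi> permutes {1..n}} (\<lambda>\<pi>. {(a, \<pi> a) |a. a \<in> V'}) (V' \<times> V) (2 / real n)"
proof
  have fV': "finite V'" using assms(2) by (rule finite_subset) simp
  show "finite (V' \<times> V)" using fV' assms by simp
  show "finite {\<pi>. \<pi> permutes {1..n}}" by (rule finite_permutations) simp
  fix T assume T: "T \<subseteq> V' \<times> V"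
  define Q where "Q = {\<pi>. \<pi> permutes {1..n} \<and> T \<subseteq> {(a, \<pi> a) |a. a \<in> V'}}"
  have "real (card Q) \<le> (2 / real n) ^ card T * fact n"
  proof (cases "Q = {}")
    case False
    then obtain \<pi> where "T \<subseteq> {(a, \<pi> a) |a. a \<in> V'}" by (auto simp: Q_def)
    then have "z = (fst z, \<pi> (fst z))" if "z \<in> T" for z using that by auto
    \<comment> \<open>A set contained in the graph of a function has distinct first coordinates, so
      it prescribes as many values as it has elements. Any other \<open>T\<close> is contained in no
      such graph, and then \<open>Q\<close> is empty.\<close>
    then have "inj_on fst T" by (metis inj_onI)
    then have cT: "card (fst ` T) = card T" by (rule card_image)
    have sub: "fst ` T \<subseteq> V'" using T by auto
    then have "card T \<le> card V'" using cT card_mono[OF fV'] by metis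
    moreover have "{1..n} \<inter> fst ` T = fst ` T" using sub assms(2) by auto
    ultimately have "card Q \<le> fact (n - card T)"
      using card_permutes_extending_le[of "{1..n}" T V'] cT by (simp add: Q_def)
    then have "real (card Q) \<le> fact (n - card T)"
      by (metis of_nat_fact of_nat_le_iff)
    also have "\<dots> \<le> (2 / real n) ^ card T * fact n"
      using assms \<open>card T \<le> card V'\<close> by (intro fact_diff_le) auto
    finally show ?thesis .
  qed simp
  then show "real (card {\<pi> \<in> {\<pi>. \<pi> permutes {1..n}}. T \<subseteq> {(a, \<pi> a) |a. a \<in> V'}})
      \<le> (2 / real n) ^ card T * real (card {\<pi>. \<pi> permutes {1..n}})"
    by (simp add: Q_def card_permutations[OF refl])
qed simp

section \<open>The second moment of the likelihood ratio\<close>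

lemma finite_all_edges [simp]: "finite V \<Longrightarrow> finite (all_edges V)"
  by (rule finite_subset[of _ "Pow V"]) (auto simp: all_edges_def)

lemma all_edges_mono: "V \<subseteq> W \<Longrightarrow> all_edges V \<subseteq> all_edges W"
  by (auto simp: all_edges_def)

lemma edges_complete_graph [simp]: "edges (complete_graph n) = all_edges {1..n}"
  and verts_complete_graph [simp]: "verts (complete_graph n) = {1..n}"
  by (simp_all add: complete_graph_def)

text \<open>The factorization behind edge independence: a sum over all graphs of an edgewise product
  is a product over edges of two-term sums.\<close>

lemma sum_Pow_prod:
  fixes f g :: "'a \<Rightarrow> real"
  assumes "finite K"
  shows "(\<Sum>G\<in>Pow K. \<Prod>e\<in>K. if e \<in> G then f e else g e) = (\<Prod>e\<in>K. f e + g e)"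
proof -
  have "(\<Sum>G\<in>Pow K. \<Prod>e\<in>K. if e \<in> G then f e else g e) = (\<Sum>G\<in>Pow K. prod f G * prod g (K - G))"
  proof (intro sum.cong refl)
    fix G assume "G \<in> Pow K"
    then show "(\<Prod>e\<in>K. if e \<in> G then f e else g e) = prod f G * prod g (K - G)"
      using assms by (simp add: prod.If_cases Int_absorb1 Diff_eq)
  qed
  with assms show ?thesis by (simp add: prod_add)
qed

lemma set_random_edges: "set_pmf (random_edges n w) \<subseteq> Pow (all_edges {1..n})"
  by (auto simp: random_edges_def)

lemma pmf_random_edges:
  assumes "\<And>e. 0 \<le> w e \<and> w e \<le> 1" "G \<subseteq> all_edges {1..n}"
  shows "pmf (random_edges n w) G = (\<Prod>e\<in>all_edges {1..n}. if e \<in> G then w e else 1 - w e)"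
proof -
  let ?K = "all_edges {1..n}"
  have "(\<lambda>f. {e \<in> ?K. f e}) -` {G} = Pi ?K (\<lambda>e. {e \<in> G})"
    using assms(2) by (auto simp: Pi_def)
  then have "pmf (random_edges n w) G = (\<Prod>e\<in>?K. measure_pmf.prob (bernoulli_pmf (w e)) {e \<in> G})"
    by (simp add: random_edges_def pmf_map measure_Pi_pmf_Pi)
  also have "\<dots> = (\<Prod>e\<in>?K. if e \<in> G then w e else 1 - w e)"
    using assms(1) by (intro prod.cong) (auto simp: measure_pmf_single)
  finally show ?thesis .
qed

section \<open>Copies and the action of permutations on them\<close>

lemma finite_copies [simp]: "finite (copies n \<Gamma>)"
proof (rule finite_subset)
  show "copies n \<Gamma> \<subseteq> Pow {1..n} \<times> Pow (all_edges {1..n})"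
    by (auto simp: copies_def subgraph_def)
qed auto

lemma image_all_edges_subset:
  assumes "inj_on f V" "E \<subseteq> all_edges V"
  shows "(`) f ` E \<subseteq> all_edges (f ` V)"
proof -
  have "card (f ` e) = 2" if "e \<in> E" for e
  proof -
    have "e \<subseteq> V" "card e = 2" using that assms(2) by (auto simp: all_edges_def)
    then show ?thesis using assms(1) by (metis card_image inj_on_subset)
  qed
  then show ?thesis using assms(2) by (auto simp: all_edges_def)
qed

lemma copies_nonempty:
  assumes "simple_graph \<Gamma>" "card (verts \<Gamma>) \<le> n"
  shows "copies n \<Gamma> \<noteq> {}"
proof -
  have fin: "finite (verts \<Gamma>)" using assms by (simp add: simple_graph_def)
  then obtain f where f: "f ` verts \<Gamma> \<subseteq> {1..n}" "inj_on f (verts \<Gamma>)"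
    using card_le_inj[of "verts \<Gamma>" "{1..n}"] assms by auto
  define H where "H = (f ` verts \<Gamma>, (`) f ` edges \<Gamma>)"
  have "edges H \<subseteq> all_edges (verts H)"
    using image_all_edges_subset[OF f(2), of "edges \<Gamma>"] assms by (simp add: H_def simple_graph_def)
  then have "H \<in> copies n \<Gamma>"
    using f fin by (auto simp: copies_def subgraph_def simple_graph_def isomorphic_def H_def
        all_edges_def inj_on_imp_bij_betw intro!: exI[of _ f])
  then show ?thesis by auto
qed

definition permute_graph :: "(nat \<Rightarrow> nat) \<Rightarrow> ugraph \<Rightarrow> ugraph" where
  "permute_graph \<pi> H = (\<pi> ` verts H, (`) \<pi> ` edges H)"

lemma permute_graph_copies:
  assumes \<pi>: "\<pi> permutes {1..n}" and H: "H \<in> copies n \<Gamma>"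
  shows "permute_graph \<pi> H \<in> copies n \<Gamma>"
proof -
  obtain f where f: "bij_betw f (verts \<Gamma>) (verts H)" "edges H = (`) f ` edges \<Gamma>"
    using H by (auto simp: copies_def isomorphic_def)
  have H': "verts H \<subseteq> {1..n}" "edges H \<subseteq> all_edges (verts H)" "finite (verts H)"
    using H by (auto simp: copies_def subgraph_def simple_graph_def)
  have inj: "inj_on \<pi> (verts H)"
    using \<pi> by (meson permutes_inj inj_on_subset subset_UNIV)
  have V: "\<pi> ` verts H \<subseteq> {1..n}"
    using H'(1) permutes_image[OF \<pi>] by blast
  have E: "(`) \<pi> ` edges H \<subseteq> all_edges (\<pi> ` verts H)"
    using inj H'(2) by (rule image_all_edges_subset)
  have "bij_betw (\<pi> \<circ> f) (verts \<Gamma>) (\<pi> ` verts H)"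
    using f(1) inj by (metis bij_betw_trans inj_on_imp_bij_betw)
  moreover have "(`) \<pi> ` edges H = (`) (\<pi> \<circ> f) ` edges \<Gamma>"
    by (simp add: f(2) image_comp comp_def)
  ultimately show ?thesis
    using V E all_edges_mono[OF V] H'(3)
    by (auto simp del: One_nat_def simp: copies_def subgraph_def simple_graph_def isomorphic_def
        permute_graph_def intro!: exI[of _ "\<pi> \<circ> f"])
qed

lemma bij_betw_permute_graph:
  assumes "\<pi> permutes {1..n}"
  shows "bij_betw (permute_graph \<pi>) (copies n \<Gamma>) (copies n \<Gamma>)"
proof (rule bij_betw_byWitness[where f' = "permute_graph (inv \<pi>)"])
  have "\<And>X. inv \<pi> ` \<pi> ` X = X" "\<And>X. \<pi> ` inv \<pi> ` X = X"
    using permutes_inverses[OF assms] by (auto simp: image_comp)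
  then show "\<forall>a\<in>copies n \<Gamma>. permute_graph (inv \<pi>) (permute_graph \<pi> a) = a"
    "\<forall>a\<in>copies n \<Gamma>. permute_graph \<pi> (permute_graph (inv \<pi>) a) = a"
    by (auto simp: permute_graph_def image_comp comp_def)
qed (use permute_graph_copies assms permutes_inv in blast)+

section \<open>The second moment as an average over pairs of copies\<close>

definition planted_edge_prob :: "real \<Rightarrow> real \<Rightarrow> ugraph \<Rightarrow> nat set \<Rightarrow> real" where
  "planted_edge_prob p q H e = (if e \<in> edges H then p else q)"

lemma pmf_planted:
  assumes "copies n \<Gamma> \<noteq> {}"
  shows "pmf (planted n \<Gamma> p q) G
    = (\<Sum>H\<in>copies n \<Gamma>. pmf (random_edges n (planted_edge_prob p q H)) G) / card (copies n \<Gamma>)"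
  using assms by (simp add: planted_def pmf_bind integral_pmf_of_set planted_edge_prob_def[abs_def])

lemma set_planted:
  assumes "copies n \<Gamma> \<noteq> {}"
  shows "set_pmf (planted n \<Gamma> p q) \<subseteq> Pow (all_edges {1..n})"
  using set_random_edges by (fastforce simp: planted_def)

text \<open>The sum factors over edges. An edge of both copies contributes p^2/q + (1-p)^2/(1-q),
  which is 1 + chi-squared. For any other edge one of the two weights is that of the null law and
  cancels the denominator, which leaves a total mass of 1.\<close>

lemma likelihood_product:
  assumes q: "0 < q" "q < 1" and p: "0 \<le> p" "p \<le> 1"
    and H: "edges H \<subseteq> all_edges {1..n}" and H': "edges H' \<subseteq> all_edges {1..n}"
  shows "(\<Sum>G\<in>Pow (all_edges {1..n}).
            pmf (random_edges n (planted_edge_prob p q H)) G *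
            pmf (random_edges n (planted_edge_prob p q H')) G / pmf (erdos_renyi n q) G)
         = (1 + chi2 p q) ^ card (edges H \<inter> edges H')"
proof -
  let ?K = "all_edges {1..n}"
  let ?w = "planted_edge_prob p q H" and ?w' = "planted_edge_prob p q H'"
  have "(\<Sum>G\<in>Pow ?K. pmf (random_edges n ?w) G * pmf (random_edges n ?w') G / pmf (erdos_renyi n q) G)
      = (\<Sum>G\<in>Pow ?K. \<Prod>e\<in>?K. if e \<in> G then ?w e * ?w' e / q else (1 - ?w e) * (1 - ?w' e) / (1 - q))"
  proof (intro sum.cong refl)
    fix G assume "G \<in> Pow ?K"
    then have "G \<subseteq> ?K" by auto
    then show "pmf (random_edges n ?w) G * pmf (random_edges n ?w') G / pmf (erdos_renyi n q) G
      = (\<Prod>e\<in>?K. if e \<in> G then ?w e * ?w' e / q else (1 - ?w e) * (1 - ?w' e) / (1 - q))"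
      using p q by (simp add: erdos_renyi_def pmf_random_edges planted_edge_prob_def
          flip: prod.distrib prod_dividef) (auto intro!: prod.cong)
  qed
  also have "\<dots> = (\<Prod>e\<in>?K. ?w e * ?w' e / q + (1 - ?w e) * (1 - ?w' e) / (1 - q))"
    by (rule sum_Pow_prod) simp
  also have "\<dots> = (\<Prod>e\<in>?K. if e \<in> edges H \<inter> edges H' then 1 + chi2 p q else 1)"
  proof (intro prod.cong refl)
    fix e
    have "p * p / q + (1 - p) * (1 - p) / (1 - q) = 1 + chi2 p q"
      using q by (simp add: chi2_def field_simps power2_eq_square)
    then show "?w e * ?w' e / q + (1 - ?w e) * (1 - ?w' e) / (1 - q)
        = (if e \<in> edges H \<inter> edges H' then 1 + chi2 p q else 1)"
      using q by (auto simp: planted_edge_prob_def)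
  qed
  also have "\<dots> = (1 + chi2 p q) ^ card (?K \<inter> (edges H \<inter> edges H'))"
    by (subst prod.inter_restrict[symmetric]) auto
  also have "?K \<inter> (edges H \<inter> edges H') = edges H \<inter> edges H'"
    using H by auto
  finally show ?thesis .
qed

text \<open>The null expectation of the squared likelihood ratio for 0 < q < 1, that is, 1 plus the
  chi-squared divergence of the planted law from the null law.\<close>

definition second_moment :: "nat \<Rightarrow> ugraph \<Rightarrow> real \<Rightarrow> real \<Rightarrow> real" where
  "second_moment n \<Gamma> p q = (\<Sum>G\<in>Pow (all_edges {1..n}).
     (pmf (planted n \<Gamma> p q) G)\<^sup>2 / pmf (erdos_renyi n q) G)"

lemma second_moment_eq:
  assumes q: "0 < q" "q < 1" and p: "0 \<le> p" "p \<le> 1" and ne: "copies n \<Gamma> \<noteq> {}"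
  shows "second_moment n \<Gamma> p q = (\<Sum>H\<in>copies n \<Gamma>. \<Sum>H'\<in>copies n \<Gamma>.
      (1 + chi2 p q) ^ card (edges H \<inter> edges H')) / (card (copies n \<Gamma>))\<^sup>2"
proof -
  let ?C = "copies n \<Gamma>"
  let ?P = "\<lambda>H G. pmf (random_edges n (planted_edge_prob p q H)) G"
  have "second_moment n \<Gamma> p q = (\<Sum>G\<in>Pow (all_edges {1..n}).
      \<Sum>H\<in>?C. \<Sum>H'\<in>?C. ?P H G * ?P H' G / pmf (erdos_renyi n q) G) / (card ?C)\<^sup>2"
    unfolding second_moment_def sum_divide_distrib[of _ _ "real ((card ?C)\<^sup>2)"]
    by (intro sum.cong refl)
       (simp add: pmf_planted[OF ne] power_divide power2_eq_square sum_product sum_divide_distrib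
          divide_divide_eq_left mult_ac)
  also have "(\<Sum>G\<in>Pow (all_edges {1..n}). \<Sum>H\<in>?C. \<Sum>H'\<in>?C. ?P H G * ?P H' G / pmf (erdos_renyi n q) G)
      = (\<Sum>H\<in>?C. \<Sum>H'\<in>?C. \<Sum>G\<in>Pow (all_edges {1..n}). ?P H G * ?P H' G / pmf (erdos_renyi n q) G)"
    by (subst sum.swap, intro sum.cong refl, rule sum.swap)
  also have "\<dots> = (\<Sum>H\<in>?C. \<Sum>H'\<in>?C. (1 + chi2 p q) ^ card (edges H \<inter> edges H'))"
    by (intro sum.cong refl likelihood_product assms) (auto simp: copies_def subgraph_def)
  finally show ?thesis .
qed

text \<open>
  Since a permutation of \<open>[n]\<close> permutes the copies, averaging over a random permutation of the
  second copy does not change the double sum.  No stabilisers have to be counted.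
\<close>

lemma second_moment_le:
  assumes q: "0 < q" "q < 1" and p: "0 \<le> p" "p \<le> 1" and ne: "copies n \<Gamma> \<noteq> {}"
    and B: "\<And>H H'. H \<in> copies n \<Gamma> \<Longrightarrow> H' \<in> copies n \<Gamma> \<Longrightarrow>
      (\<Sum>\<pi> | \<pi> permutes {1..n}. (1 + chi2 p q) ^ card (edges H \<inter> (`) \<pi> ` edges H')) \<le> fact n * B"
  shows "second_moment n \<Gamma> p q \<le> B"
proof -
  let ?C = "copies n \<Gamma>" and ?P = "{\<pi>. \<pi> permutes {1..n}}"
  let ?f = "\<lambda>H H'. (1 + chi2 p q) ^ card (edges H \<inter> edges H')"
  have "fact n * (\<Sum>H\<in>?C. \<Sum>H'\<in>?C. ?f H H') = (\<Sum>\<pi>\<in>?P. \<Sum>H\<in>?C. \<Sum>H'\<in>?C. ?f H H')"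
    by (simp add: card_permutations[OF refl])
  also have "\<dots> = (\<Sum>\<pi>\<in>?P. \<Sum>H\<in>?C. \<Sum>H'\<in>?C. ?f H (permute_graph \<pi> H'))"
    by (intro sum.cong refl sum.reindex_bij_betw[symmetric] bij_betw_permute_graph) auto
  also have "\<dots> = (\<Sum>H\<in>?C. \<Sum>H'\<in>?C. \<Sum>\<pi>\<in>?P. ?f H (permute_graph \<pi> H'))"
    by (subst sum.swap, intro sum.cong refl, rule sum.swap)
  also have "\<dots> \<le> (\<Sum>H\<in>?C. \<Sum>H'\<in>?C. fact n * B)"
    using B by (intro sum_mono) (simp add: permute_graph_def)
  also have "\<dots> = fact n * (real ((card ?C)\<^sup>2) * B)"
    by (simp add: power2_eq_square)
  finally have "(\<Sum>H\<in>?C. \<Sum>H'\<in>?C. ?f H H') \<le> real ((card ?C)\<^sup>2) * B"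
    by simp
  moreover have "card ?C > 0" using ne by (simp add: card_gt_0_iff)
  ultimately show ?thesis
    by (subst second_moment_eq[OF q p ne], subst pos_divide_le_eq) (use ne in \<open>simp_all add: mult.commute\<close>)
qed

section \<open>From the second moment to the optimal risk\<close>

lemma prob_bind_test:
  assumes "set_pmf M \<subseteq> Pow (all_edges {1..n})"
  shows "measure_pmf.prob (bind_pmf M \<phi>) {b} = (\<Sum>G\<in>Pow (all_edges {1..n}). pmf M G * pmf (\<phi> G) b)"
  using assms by (subst measure_pmf_single, subst pmf_bind, subst integral_measure_pmf) auto

lemma sum_pmf_edges:
  assumes "set_pmf M \<subseteq> Pow (all_edges {1..n})"
  shows "(\<Sum>G\<in>Pow (all_edges {1..n}). pmf M G) = 1"
  using assms by (intro sum_pmf_eq_1) auto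

text \<open>The risk falls short of 1 by the sum of \<open>(g - f)\<close> weighted with acceptance
  probabilities, which is at most the L1 distance of the laws. Every graph has positive null mass
  \<open>f\<close>, so Cauchy-Schwarz can be applied with weight \<open>sqrt f\<close>: one factor
  has total mass 1, the other is the sum of \<open>g\<^sup>2 / f - 2 * g + f\<close>, which is the
  second moment minus 1.\<close>

lemma risk_ge:
  assumes q: "0 < q" "q < 1" and ne: "copies n \<Gamma> \<noteq> {}"
  shows "risk n \<Gamma> p q \<phi> \<ge> 1 - sqrt (second_moment n \<Gamma> p q - 1)"
proof -
  let ?K = "all_edges {1..n}"
  define f where "f = pmf (erdos_renyi n q)"
  define g where "g = pmf (planted n \<Gamma> p q)"
  have sf: "set_pmf (erdos_renyi n q) \<subseteq> Pow ?K"
    unfolding erdos_renyi_def by (rule set_random_edges)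
  have f1: "sum f (Pow ?K) = 1" and g1: "sum g (Pow ?K) = 1"
    unfolding f_def g_def by (rule sum_pmf_edges[OF sf], rule sum_pmf_edges[OF set_planted[OF ne]])
  have fpos: "f G > 0" if "G \<in> Pow ?K" for G
    using that q by (auto simp: f_def erdos_renyi_def pmf_random_edges intro!: prod_pos)
  have \<phi>F: "pmf (\<phi> G) False = 1 - pmf (\<phi> G) True" for G
    by (rule pmf_False_conv_True)
  have "risk n \<Gamma> p q \<phi> = (\<Sum>G\<in>Pow ?K. f G * pmf (\<phi> G) True) + (\<Sum>G\<in>Pow ?K. g G * (1 - pmf (\<phi> G) True))"
    by (simp add: risk_def prob_bind_test[OF sf] prob_bind_test[OF set_planted[OF ne]] \<phi>F f_def g_def)
  also have "\<dots> = sum g (Pow ?K) - (\<Sum>G\<in>Pow ?K. (g G - f G) * pmf (\<phi> G) True)"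
    by (simp add: algebra_simps sum.distrib sum_subtractf)
  also note g1
  finally have risk: "risk n \<Gamma> p q \<phi> = 1 - (\<Sum>G\<in>Pow ?K. (g G - f G) * pmf (\<phi> G) True)" .
  have "(\<Sum>G\<in>Pow ?K. (g G - f G) * pmf (\<phi> G) True) \<le> (\<Sum>G\<in>Pow ?K. \<bar>g G - f G\<bar>)"
  proof (rule sum_mono)
    fix G
    have "(g G - f G) * pmf (\<phi> G) True \<le> \<bar>g G - f G\<bar> * pmf (\<phi> G) True"
      by (intro mult_right_mono) auto
    also have "\<dots> \<le> \<bar>g G - f G\<bar>"
      by (intro mult_left_le) (auto simp: pmf_le_1)
    finally show "(g G - f G) * pmf (\<phi> G) True \<le> \<bar>g G - f G\<bar>" .
  qed
  also have "\<dots> \<le> sqrt (second_moment n \<Gamma> p q - 1)"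
  proof (rule real_le_rsqrt)
    have "(\<Sum>G\<in>Pow ?K. \<bar>g G - f G\<bar>) = (\<Sum>G\<in>Pow ?K. sqrt (f G) * (\<bar>g G - f G\<bar> / sqrt (f G)))"
    proof (intro sum.cong refl)
      fix G assume "G \<in> Pow ?K"
      then have "sqrt (f G) \<noteq> 0" using fpos[of G] by simp
      then show "\<bar>g G - f G\<bar> = sqrt (f G) * (\<bar>g G - f G\<bar> / sqrt (f G))" by simp
    qed
    then have "(\<Sum>G\<in>Pow ?K. \<bar>g G - f G\<bar>)\<^sup>2
        \<le> (\<Sum>G\<in>Pow ?K. (sqrt (f G))\<^sup>2) * (\<Sum>G\<in>Pow ?K. (\<bar>g G - f G\<bar> / sqrt (f G))\<^sup>2)"
      by (simp only: Cauchy_Schwarz_ineq_sum)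
    also have "(\<Sum>G\<in>Pow ?K. (sqrt (f G))\<^sup>2) = 1"
      using f1 by (simp add: f_def)
    also have "(\<Sum>G\<in>Pow ?K. (\<bar>g G - f G\<bar> / sqrt (f G))\<^sup>2) = (\<Sum>G\<in>Pow ?K. (g G)\<^sup>2 / f G - 2 * g G + f G)"
    proof (intro sum.cong refl)
      fix G assume "G \<in> Pow ?K"
      then show "(\<bar>g G - f G\<bar> / sqrt (f G))\<^sup>2 = (g G)\<^sup>2 / f G - 2 * g G + f G"
        using fpos[of G] by (simp add: power_divide field_simps power2_eq_square)
    qed
    also have "\<dots> = second_moment n \<Gamma> p q - 1"
      by (simp del: One_nat_def add: sum.distrib sum_subtractf f1 g1 second_moment_def f_def[symmetric] g_def[symmetric]
          flip: sum_distrib_left)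
    finally show "(\<Sum>G\<in>Pow ?K. \<bar>g G - f G\<bar>)\<^sup>2 \<le> second_moment n \<Gamma> p q - 1" by simp
  qed
  finally show ?thesis using risk by simp
qed

lemma optimal_risk_bounds:
  assumes q: "0 < q" "q < 1" and ne: "copies n \<Gamma> \<noteq> {}"
  shows "optimal_risk n \<Gamma> p q \<le> 1" "optimal_risk n \<Gamma> p q \<ge> 1 - sqrt (second_moment n \<Gamma> p q - 1)"
proof -
  show "optimal_risk n \<Gamma> p q \<ge> 1 - sqrt (second_moment n \<Gamma> p q - 1)"
    unfolding optimal_risk_def using risk_ge[OF assms] by (intro cINF_greatest) auto
  have "risk n \<Gamma> p q (\<lambda>_. return_pmf True) = 1"
    by (simp add: risk_def measure_pmf_single)
  \<comment> \<open>An infimum of reals lies below its members only if the set is bounded below; the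
    bound on all risks just proved supplies this.\<close>
  moreover have "bdd_below (range (risk n \<Gamma> p q))"
    using risk_ge[OF assms] by (intro bdd_belowI2)
  ultimately show "optimal_risk n \<Gamma> p q \<le> 1"
    unfolding optimal_risk_def by (metis cINF_lower UNIV_I)
qed

text \<open>The optimal risk is squeezed between \<open>1 - sqrt (exp (h n) - 1)\<close> and 1. The
  exponential form is the one in which both second moment bounds arrive.\<close>

lemma weak_detection_impossibleI:
  assumes pq: "\<forall>n\<ge>2. 0 < q n \<and> q n < 1 \<and> q n < p n \<and> p n \<le> 1"
    and \<Gamma>: "planted_sequence \<Gamma>"
    and le: "\<forall>\<^sub>F n in sequentially. second_moment n (\<Gamma> n) (p n) (q n) \<le> exp (h n)"
    and h: "h \<longlonglongrightarrow> 0"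
  shows "weak_detection_impossible \<Gamma> p q"
  unfolding weak_detection_impossible_def
proof (rule tendsto_sandwich)
  have ne: "copies n (\<Gamma> n) \<noteq> {}" if "n \<ge> 2" for n
    using \<Gamma> that by (intro copies_nonempty) (auto simp: planted_sequence_def)
  show "\<forall>\<^sub>F n in sequentially. 1 - sqrt (exp (h n) - 1) \<le> optimal_risk n (\<Gamma> n) (p n) (q n)"
    using le eventually_ge_at_top[of 2]
  proof eventually_elim
    case (elim n)
    have "1 - sqrt (second_moment n (\<Gamma> n) (p n) (q n) - 1) \<le> optimal_risk n (\<Gamma> n) (p n) (q n)"
      using pq elim(2) ne by (intro optimal_risk_bounds) auto
    moreover have "sqrt (second_moment n (\<Gamma> n) (p n) (q n) - 1) \<le> sqrt (exp (h n) - 1)"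
      using elim(1) by simp
    ultimately show ?case by linarith
  qed
  show "\<forall>\<^sub>F n in sequentially. optimal_risk n (\<Gamma> n) (p n) (q n) \<le> 1"
    using eventually_ge_at_top[of 2]
    by eventually_elim (use pq ne in \<open>auto intro!: optimal_risk_bounds\<close>)
  have "(\<lambda>n. 1 - sqrt (exp (h n) - 1)) \<longlonglongrightarrow> 1 - sqrt (exp 0 - 1)"
    by (intro tendsto_intros h)
  then show "(\<lambda>n. 1 - sqrt (exp (h n) - 1)) \<longlonglongrightarrow> 1" by simp
qed simp

section \<open>Intersections of two copies\<close>

lemma finite_densities:
  assumes "simple_graph \<Gamma>"
  shows "finite {real (card (edges H)) / real (card (verts H)) | H. subgraph H \<Gamma> \<and> verts H \<noteq> {}}"
proof -
  have "finite (edges \<Gamma>)" "finite (verts \<Gamma>)"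
    using assms by (auto simp: simple_graph_def intro: finite_subset[of _ "all_edges (verts \<Gamma>)"])
  moreover have "{H. subgraph H \<Gamma> \<and> verts H \<noteq> {}} \<subseteq> Pow (verts \<Gamma>) \<times> Pow (edges \<Gamma>)"
    by (auto simp: subgraph_def)
  ultimately have "finite {H. subgraph H \<Gamma> \<and> verts H \<noteq> {}}"
    by (meson finite_Pow_iff finite_SigmaI finite_subset)
  then show ?thesis by (rule finite_image_set)
qed

lemma card_edges_le_max_density:
  assumes "simple_graph \<Gamma>" "subgraph H \<Gamma>" "verts H \<noteq> {}"
  shows "real (card (edges H)) \<le> max_density \<Gamma> * real (card (verts H))"
proof -
  have "real (card (edges H)) / real (card (verts H)) \<le> max_density \<Gamma>"
    unfolding max_density_def
    by (rule Max_ge[OF finite_densities[OF assms(1)]]) (use assms in blast)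
  moreover have "card (verts H) > 0"
    using assms by (simp add: subgraph_def simple_graph_def card_gt_0_iff)
  ultimately show ?thesis by (simp add: pos_divide_le_eq)
qed

lemma max_density_attained:
  assumes "simple_graph \<Gamma>" "verts \<Gamma> \<noteq> {}"
  obtains H where "subgraph H \<Gamma>" "verts H \<noteq> {}"
    "real (card (edges H)) = max_density \<Gamma> * real (card (verts H))"
proof -
  have "subgraph \<Gamma> \<Gamma>" using assms by (simp add: subgraph_def)
  then have "{real (card (edges H)) / real (card (verts H)) | H. subgraph H \<Gamma> \<and> verts H \<noteq> {}} \<noteq> {}"
    using assms by blast
  from Max_in[OF finite_densities[OF assms(1)] this]
  obtain H where H: "subgraph H \<Gamma>" "verts H \<noteq> {}"
    "max_density \<Gamma> = real (card (edges H)) / real (card (verts H))"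
    unfolding max_density_def by blast
  then have "card (verts H) > 0" by (simp add: subgraph_def simple_graph_def card_gt_0_iff)
  with H show ?thesis by (intro that) auto
qed

lemma max_density_nonneg:
  assumes "simple_graph \<Gamma>" "verts \<Gamma> \<noteq> {}"
  shows "max_density \<Gamma> \<ge> 0"
proof -
  obtain v where "v \<in> verts \<Gamma>" using assms by auto
  then have "subgraph ({v}, {}) \<Gamma>" by (simp add: subgraph_def simple_graph_def)
  from card_edges_le_max_density[OF assms(1) this] show ?thesis by simp
qed

section \<open>Counts, degrees and densities in copies\<close>

lemma copiesE:
  assumes "H \<in> copies n \<Gamma>"
  obtains f where "bij_betw f (verts \<Gamma>) (verts H)" "edges H = (`) f ` edges \<Gamma>"
    "verts H \<subseteq> {1..n}" "edges H \<subseteq> all_edges (verts H)" "finite (verts H)"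
  using assms by (auto simp: copies_def subgraph_def simple_graph_def isomorphic_def)

lemma card_verts_copy: "H \<in> copies n \<Gamma> \<Longrightarrow> card (verts H) = card (verts \<Gamma>)"
  by (erule copiesE) (simp add: bij_betw_same_card)

lemma inj_on_image_edges:
  assumes "simple_graph \<Gamma>" "inj_on f (verts \<Gamma>)"
  shows "inj_on ((`) f) (edges \<Gamma>)"
  using inj_on_subset[OF inj_on_image_Pow[OF assms(2)]] assms(1)
  by (auto simp: simple_graph_def all_edges_def)

lemma card_edges_copy:
  assumes "simple_graph \<Gamma>" "H \<in> copies n \<Gamma>"
  shows "card (edges H) = card (edges \<Gamma>)"
  using assms(2) by (rule copiesE) (metis assms(1) bij_betw_def card_image inj_on_image_edges)

lemma degree_image:
  assumes \<Gamma>: "simple_graph \<Gamma>" and f: "inj_on f (verts \<Gamma>)" "edges H = (`) f ` edges \<Gamma>"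
    and u: "u \<in> verts \<Gamma>"
  shows "degree H (f u) = degree \<Gamma> u"
proof -
  have "f u \<in> f ` e \<longleftrightarrow> u \<in> e" if "e \<in> edges \<Gamma>" for e
    using \<Gamma> that by (intro inj_on_image_mem_iff[OF f(1) u]) (auto simp: simple_graph_def all_edges_def)
  then have "{e \<in> edges H. f u \<in> e} = (`) f ` {e \<in> edges \<Gamma>. u \<in> e}"
    by (auto simp: f(2))
  then show ?thesis
    unfolding degree_def
    using inj_on_subset[OF inj_on_image_edges[OF \<Gamma> f(1)]] by (simp add: card_image)
qed

lemma card_neighbours_copy_le:
  assumes \<Gamma>: "simple_graph \<Gamma>" and H: "H \<in> copies n \<Gamma>"
  shows "card {b. {a, b} \<in> edges H} \<le> max_degree \<Gamma>"
proof (cases "a \<in> verts H")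
  case True
  obtain f where f: "bij_betw f (verts \<Gamma>) (verts H)" "edges H = (`) f ` edges \<Gamma>"
    and E: "edges H \<subseteq> all_edges (verts H)" "finite (verts H)"
    using H by (rule copiesE)
  obtain u where u: "u \<in> verts \<Gamma>" "a = f u"
    using f(1) True by (auto simp: bij_betw_def)
  have fin: "finite (edges H)"
    using E by (auto intro: finite_subset)
  have "card {b. {a, b} \<in> edges H} \<le> card {e \<in> edges H. a \<in> e}"
    using fin by (intro card_inj_on_le[where f = "\<lambda>b. {a, b}"]) (auto simp: inj_on_def doubleton_eq_iff)
  also have "\<dots> = degree \<Gamma> u"
    using degree_image[OF \<Gamma> _ f(2) u(1)] f(1) u(2) by (simp add: bij_betw_def degree_def)
  also have "\<dots> \<le> max_degree \<Gamma>"
    unfolding max_degree_def using \<Gamma> u(1) by (intro Max_ge) (auto simp: simple_graph_def)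
  finally show ?thesis .
next
  case False
  then have "{b. {a, b} \<in> edges H} = {}"
    using H by (auto simp: copies_def subgraph_def simple_graph_def all_edges_def)
  then show ?thesis by (simp only: card.empty)
qed

text \<open>Pulled back along the isomorphism, \<open>F\<close> becomes the edge set of a subgraph
  of \<Gamma> on the preimage of \<open>X\<close>, to which the definition of \<mu> applies.
  \<open>X\<close> may contain points outside \<open>H\<close>; they have no preimage and only
  weaken the bound.\<close>

lemma card_edges_copy_le:
  assumes \<Gamma>: "simple_graph \<Gamma>" "verts \<Gamma> \<noteq> {}" and H: "H \<in> copies n \<Gamma>"
    and F: "F \<subseteq> edges H" "F \<subseteq> all_edges X" and X: "finite X"
  shows "real (card F) \<le> max_density \<Gamma> * real (card X)"
proof (cases "F = {}")
  case True
  then show ?thesis using max_density_nonneg[OF \<Gamma>] by simp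
next
  case False
  obtain f where f: "bij_betw f (verts \<Gamma>) (verts H)" "edges H = (`) f ` edges \<Gamma>"
    using H by (rule copiesE)
  define Y where "Y = {v \<in> verts \<Gamma>. f v \<in> X}"
  define F' where "F' = {e \<in> edges \<Gamma>. f ` e \<in> F}"
  have sub: "subgraph (Y, F') \<Gamma>"
    using \<Gamma>(1) F(2) by (auto simp: subgraph_def simple_graph_def Y_def F'_def all_edges_def)
  have "finite (edges \<Gamma>)"
    using \<Gamma>(1) by (auto simp: simple_graph_def intro: finite_subset[of _ "all_edges (verts \<Gamma>)"])
  then have "finite F'" by (simp add: F'_def)
  moreover have FF': "F \<subseteq> (`) f ` F'" using F(1) f(2) by (auto simp: F'_def)
  ultimately have "card F \<le> card F'" by (rule surj_card_le)
  moreover have "Y \<noteq> {}"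
  proof -
    obtain e where e: "e \<in> edges \<Gamma>" "f ` e \<in> F" using False FF' by (auto simp: F'_def)
    then have "e \<noteq> {}" "e \<subseteq> verts \<Gamma>" "f ` e \<subseteq> X"
      using \<Gamma>(1) F(2) by (auto simp: simple_graph_def all_edges_def)
    then show ?thesis by (auto simp: Y_def)
  qed
  then have "real (card F') \<le> max_density \<Gamma> * real (card Y)"
    using card_edges_le_max_density[OF \<Gamma>(1) sub] by simp
  moreover have "card Y \<le> card X"
    using f(1) X by (intro card_inj_on_le[where f = f]) (auto simp: Y_def bij_betw_def inj_on_def)
  ultimately show ?thesis
    using max_density_nonneg[OF \<Gamma>] by (smt (verit) mult_left_mono of_nat_le_iff)
qed

text \<open>In the applications \<open>W\<close> consists of pairs (a, \<pi> a) and \<open>g\<close>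
  is \<open>snd\<close>. An image is never larger than its source, so pairs can be counted in place
  of vertices.\<close>

lemma power_card_edges_copy_le:
  assumes \<Gamma>: "simple_graph \<Gamma>" "verts \<Gamma> \<noteq> {}" and H: "H \<in> copies n \<Gamma>"
    and F: "F \<subseteq> edges H" "F \<subseteq> all_edges (g ` W)" and W: "finite W" and y: "y \<ge> 0"
  shows "(1 + y) ^ card F \<le> ((1 + y) powr max_density \<Gamma>) ^ card W"
proof -
  have "real (card F) \<le> max_density \<Gamma> * real (card (g ` W))"
    using W by (intro card_edges_copy_le[OF \<Gamma> H F]) auto
  also have "\<dots> \<le> max_density \<Gamma> * real (card W)"
    using W max_density_nonneg[OF \<Gamma>] by (intro mult_left_mono) (auto intro: card_image_le)
  finally have "(1 + y) powr card F \<le> (1 + y) powr (max_density \<Gamma> * real (card W))"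
    using y by (intro powr_mono) auto
  then show ?thesis
    using y by (simp add: powr_realpow flip: powr_powr)
qed

text \<open>Both ends of a common edge are common vertices, which correspond to the pairs in
  \<open>R \<pi> \<inter> D\<close>. Now \<open>moment_le\<close> with nothing forced treats the k^2
  pairs of \<open>D\<close> as events of probability 2/n, each carrying a factor x, which gives the
  exponent 2 x k^2 / n.\<close>

lemma second_moment_le_vertices:
  assumes q: "0 < q" "q < 1" and p: "0 \<le> p" "p \<le> 1"
    and \<Gamma>: "simple_graph \<Gamma>" "verts \<Gamma> \<noteq> {}" and n: "2 * card (verts \<Gamma>) \<le> n"
  shows "second_moment n \<Gamma> p q
    \<le> exp (2 * (1 + chi2 p q) powr max_density \<Gamma> * (real (card (verts \<Gamma>)))\<^sup>2 / real n)"
proof (rule second_moment_le[OF q p])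
  have "card (verts \<Gamma>) > 0"
    using \<Gamma> by (simp add: simple_graph_def card_gt_0_iff)
  with n have n0: "n > 0" by simp
  show "copies n \<Gamma> \<noteq> {}" using \<Gamma> n by (intro copies_nonempty) auto
  fix H H' assume H: "H \<in> copies n \<Gamma>" and H': "H' \<in> copies n \<Gamma>"
  define x where "x = (1 + chi2 p q) powr max_density \<Gamma>"
  define D where "D = verts H' \<times> verts H"
  define R where "R \<pi> = {(a, \<pi> a) |a. a \<in> verts H'}" for \<pi> :: "nat \<Rightarrow> nat"
  have chi: "chi2 p q \<ge> 0" using q by (simp add: chi2_def)
  then have x: "x \<ge> 1" using max_density_nonneg[OF \<Gamma>] by (simp add: x_def ge_one_powr_ge_zero)
  have V: "finite (verts H)" "edges H \<subseteq> all_edges (verts H)" using H by (auto elim: copiesE)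
  have V': "finite (verts H')" "edges H' \<subseteq> all_edges (verts H')" "verts H' \<subseteq> {1..n}"
    using H' by (blast elim: copiesE)+
  interpret sparse_random_set "{\<pi>. \<pi> permutes {1..n}}" R D "2 / real n"
    unfolding R_def D_def using V V' n n0 by (intro sparse_permutation) (auto simp: card_verts_copy[OF H'])
  have "(\<Sum>\<pi> | \<pi> permutes {1..n}. (1 + chi2 p q) ^ card (edges H \<inter> (`) \<pi> ` edges H'))
      \<le> (\<Sum>\<pi> | \<pi> permutes {1..n}. x ^ card (R \<pi> \<inter> D))"
  proof (rule sum_mono)
    fix \<pi>
    have "edges H \<inter> (`) \<pi> ` edges H' \<subseteq> all_edges (snd ` (R \<pi> \<inter> D))"
    proof
      fix e assume "e \<in> edges H \<inter> (`) \<pi> ` edges H'"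
      then obtain e' where e: "e \<in> edges H" and e': "e' \<in> edges H'" "e = \<pi> ` e'" by auto
      then have "e' \<subseteq> verts H'" "e \<subseteq> verts H" "card e = 2"
        using V(2) V'(2) unfolding all_edges_def by blast+
      then have "(\<lambda>a. (a, \<pi> a)) ` e' \<subseteq> R \<pi> \<inter> D"
        using e'(2) by (auto simp: R_def D_def)
      then have "snd ` (\<lambda>a. (a, \<pi> a)) ` e' \<subseteq> snd ` (R \<pi> \<inter> D)" by (rule image_mono)
      then show "e \<in> all_edges (snd ` (R \<pi> \<inter> D))"
        using e'(2) \<open>card e = 2\<close> by (simp add: all_edges_def image_image)
    qed
    then show "(1 + chi2 p q) ^ card (edges H \<inter> (`) \<pi> ` edges H') \<le> x ^ card (R \<pi> \<inter> D)"
      unfolding x_def using finite_N chi by (intro power_card_edges_copy_le[OF \<Gamma> H]) auto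
  qed
  also have "\<dots> \<le> fact n * (1 + 2 / real n * (x - 1)) ^ card D"
    using moment_le[of "{}" D "x - 1"] x by (simp add: card_permutations[OF refl])
  also have "\<dots> \<le> fact n * exp (real (card D) * (2 / real n * (x - 1)))"
    using x by (intro mult_left_mono one_plus_power_le_exp) auto
  also have "\<dots> \<le> fact n * exp (2 * x * (real (card (verts \<Gamma>)))\<^sup>2 / real n)"
  proof (intro mult_left_mono, subst exp_le_cancel_iff)
    have "real (card D) * (2 / real n * (x - 1)) \<le> real (card D) * (2 / real n * x)"
      by (intro mult_left_mono) auto
    also have "\<dots> = 2 * x * (real (card (verts \<Gamma>)))\<^sup>2 / real n"
      by (simp add: D_def card_cartesian_product card_verts_copy[OF H] card_verts_copy[OF H']
          power2_eq_square)
    finally show "real (card D) * (2 / real n * (x - 1)) \<le> 2 * x * (real (card (verts \<Gamma>)))\<^sup>2 / real n" .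
  qed simp
  finally show "(\<Sum>\<pi> | \<pi> permutes {1..n}. (1 + chi2 p q) ^ card (edges H \<inter> (`) \<pi> ` edges H'))
      \<le> fact n * exp (2 * (1 + chi2 p q) powr max_density \<Gamma> * (real (card (verts \<Gamma>)))\<^sup>2 / real n)"
    by (simp add: x_def)
qed

text \<open>
  The edges common to \<open>H\<close> and \<open>\<pi>(H')\<close> are the edges of the tensor product of \<open>H'\<close> and \<open>H\<close> whose
  two end points lie on the graph of the random permutation \<open>\<pi>\<close>.
\<close>

definition tensor_edges :: "ugraph \<Rightarrow> ugraph \<Rightarrow> (nat \<times> nat) set set" where
  "tensor_edges H' H = {t. card t = 2 \<and> fst ` t \<in> edges H' \<and> snd ` t \<in> edges H}"

lemma subset_fst_times_snd: "t \<subseteq> fst ` t \<times> snd ` t"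
  by force

lemma tensor_edges_subset:
  assumes "edges H' \<subseteq> all_edges V'" "edges H \<subseteq> all_edges V" "t \<in> tensor_edges H' H"
  shows "t \<subseteq> V' \<times> V"
proof -
  have "fst ` t \<subseteq> V'" "snd ` t \<subseteq> V"
    using assms unfolding tensor_edges_def all_edges_def by blast+
  then show ?thesis using subset_fst_times_snd[of t] by blast
qed

text \<open>The 6 is the number of two-element subsets of the four points of
  \<open>e' \<times> e\<close>, a crude count for each pair of edges.\<close>

lemma tensor_edges_finite_card:
  assumes E: "edges H' \<subseteq> all_edges V'" "edges H \<subseteq> all_edges V" and fin: "finite V'" "finite V"
  shows "finite (tensor_edges H' H)" "card (tensor_edges H' H) \<le> 6 * (card (edges H') * card (edges H))"
proof -
  let ?I = "edges H' \<times> edges H"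
  let ?T = "\<lambda>(e', e). {t. t \<subseteq> e' \<times> e \<and> card t = 2}"
  have finI: "finite ?I"
    using E fin by (auto intro: finite_subset[OF _ finite_all_edges])
  have T: "finite (?T i) \<and> card (?T i) \<le> 6" if i: "i \<in> ?I" for i
  proof -
    obtain e' e where [simp]: "i = (e', e)" by (cases i)
    have e: "card e' = 2" "card e = 2" using i E by (auto simp: all_edges_def)
    then have "finite e'" "finite e" by (simp_all add: card_ge_0_finite)
    note e = e this
    have "card (e' \<times> e) = 4" using e by (simp add: card_cartesian_product)
    then have "card {t. t \<subseteq> e' \<times> e \<and> card t = 2} = 4 choose 2"
      using n_subsets[of "e' \<times> e" 2] e by simp
    moreover have "finite {t. t \<subseteq> e' \<times> e \<and> card t = 2}"
      by (rule finite_subset[of _ "Pow (e' \<times> e)"]) (blast, simp add: e)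
    ultimately show ?thesis by (simp add: choose_two)
  qed
  have sub: "tensor_edges H' H \<subseteq> (\<Union>i\<in>?I. ?T i)"
  proof
    fix t assume "t \<in> tensor_edges H' H"
    then have "fst ` t \<in> edges H'" "snd ` t \<in> edges H" "card t = 2"
      by (simp_all add: tensor_edges_def)
    then show "t \<in> (\<Union>i\<in>?I. ?T i)"
      by (intro UN_I[of "(fst ` t, snd ` t)"]) (simp_all add: subset_fst_times_snd)
  qed
  have finU: "finite (\<Union>i\<in>?I. ?T i)" using finI T by (intro finite_UN_I) auto
  show "finite (tensor_edges H' H)" using sub finU by (rule finite_subset)
  have "card (tensor_edges H' H) \<le> card (\<Union>i\<in>?I. ?T i)"
    using finU sub by (rule card_mono)
  also have "\<dots> \<le> (\<Sum>i\<in>?I. card (?T i))" using finI by (rule card_UN_le)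
  also have "\<dots> \<le> (\<Sum>i\<in>?I. 6)" using T by (intro sum_mono) auto
  finally show "card (tensor_edges H' H) \<le> 6 * (card (edges H') * card (edges H))"
    by (simp add: card_cartesian_product)
qed

text \<open>A neighbour in the tensor product is a pair of neighbours, one in each factor. This is
  how the square of the maximum degree enters the threshold.\<close>

lemma tensor_edges_degree_le:
  assumes "\<And>a. card {b. {a, b} \<in> edges H'} \<le> d" "\<And>a. card {b. {a, b} \<in> edges H} \<le> d"
    and "edges H' \<subseteq> all_edges V'" "edges H \<subseteq> all_edges V" "finite V'" "finite V"
  shows "card {z'. {z, z'} \<in> tensor_edges H' H} \<le> d\<^sup>2"
proof -
  let ?N' = "{b. {fst z, b} \<in> edges H'}" and ?N = "{b. {snd z, b} \<in> edges H}"
  have "?N' \<subseteq> V'" "?N \<subseteq> V" using assms(3,4) by (auto simp: all_edges_def)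
  then have fin: "finite ?N'" "finite ?N" using assms(5,6) by (auto intro: finite_subset)
  have "card {z'. {z, z'} \<in> tensor_edges H' H} \<le> card (?N' \<times> ?N)"
    using fin by (intro card_mono) (auto simp: tensor_edges_def)
  also have "\<dots> \<le> d * d"
    using assms(1,2) by (simp add: card_cartesian_product mult_le_mono)
  finally show ?thesis by (simp add: power2_eq_square)
qed

text \<open>Here only the set \<open>W \<pi>\<close> is charged: the points of the graph of \<pi>
  that lie on a tensor edge inside it. \<open>covered_moment_le\<close> then applies with \<theta> =
  2/n, at most 6 |e|^2 tensor edges and degrees at most d_max^2.\<close>

lemma second_moment_le_edges:
  assumes q: "0 < q" "q < 1" and p: "0 \<le> p" "p \<le> 1"
    and \<Gamma>: "simple_graph \<Gamma>" "verts \<Gamma> \<noteq> {}" and n: "2 * card (verts \<Gamma>) \<le> n"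
  defines "x \<equiv> (1 + chi2 p q) powr max_density \<Gamma>"
  shows "second_moment n \<Gamma> p q
    \<le> exp (6 * (real (card (edges \<Gamma>)))\<^sup>2 *
        ((x * (2 / real n))\<^sup>2 * exp (2 * real ((max_degree \<Gamma>)\<^sup>2) * (x * (2 / real n)))))"
proof (rule second_moment_le[OF q p])
  have "card (verts \<Gamma>) > 0"
    using \<Gamma> by (simp add: simple_graph_def card_gt_0_iff)
  with n have n0: "n > 0" by simp
  show "copies n \<Gamma> \<noteq> {}" using \<Gamma> n by (intro copies_nonempty) auto
  fix H H' assume H: "H \<in> copies n \<Gamma>" and H': "H' \<in> copies n \<Gamma>"
  define \<E> where "\<E> = tensor_edges H' H"
  define R where "R \<pi> = {(a, \<pi> a) |a. a \<in> verts H'}" for \<pi> :: "nat \<Rightarrow> nat"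
  define W where "W \<pi> = \<Union>{t \<in> \<E>. t \<subseteq> R \<pi>}" for \<pi>
  have chi: "chi2 p q \<ge> 0" using q by (simp add: chi2_def)
  then have x: "x \<ge> 1" using max_density_nonneg[OF \<Gamma>] by (simp add: x_def ge_one_powr_ge_zero)
  have V: "finite (verts H)" "edges H \<subseteq> all_edges (verts H)" using H by (auto elim: copiesE)
  have V': "finite (verts H')" "edges H' \<subseteq> all_edges (verts H')" "verts H' \<subseteq> {1..n}"
    using H' by (blast elim: copiesE)+
  interpret sparse_random_set "{\<pi>. \<pi> permutes {1..n}}" R "verts H' \<times> verts H" "2 / real n"
    unfolding R_def using V V' n n0 by (intro sparse_permutation) (auto simp: card_verts_copy[OF H'])
  have \<E>: "finite \<E>" "card \<E> \<le> 6 * (card (edges \<Gamma>) * card (edges \<Gamma>))"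
    using tensor_edges_finite_card[OF V'(2) V(2) V'(1) V(1)]
    by (simp_all add: \<E>_def card_edges_copy[OF \<Gamma>(1) H] card_edges_copy[OF \<Gamma>(1) H'])
  have \<E>N: "t \<subseteq> verts H' \<times> verts H \<and> card t = 2" if "t \<in> \<E>" for t
    using that tensor_edges_subset[OF V'(2) V(2)] by (auto simp: \<E>_def tensor_edges_def)
  have deg: "card {z'. {z, z'} \<in> \<E>} \<le> (max_degree \<Gamma>)\<^sup>2" for z
    unfolding \<E>_def using V V' card_neighbours_copy_le[OF \<Gamma>(1) H] card_neighbours_copy_le[OF \<Gamma>(1) H']
    by (intro tensor_edges_degree_le[of H' _ H "verts H'" "verts H"]) auto
  have "(\<Sum>\<pi> | \<pi> permutes {1..n}. (1 + chi2 p q) ^ card (edges H \<inter> (`) \<pi> ` edges H'))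
      \<le> (\<Sum>\<pi> | \<pi> permutes {1..n}. x ^ card (W \<pi>))"
  proof (rule sum_mono)
    fix \<pi> assume "\<pi> \<in> {\<pi>. \<pi> permutes {1..n}}"
    then have inj: "inj \<pi>" by (auto intro: permutes_inj)
    have "edges H \<inter> (`) \<pi> ` edges H' \<subseteq> all_edges (snd ` W \<pi>)"
    proof
      fix e assume e: "e \<in> edges H \<inter> (`) \<pi> ` edges H'"
      then obtain e' where e': "e' \<in> edges H'" "e = \<pi> ` e'" by auto
      then have "e' \<subseteq> verts H'" "card e' = 2" using V'(2) by (auto simp: all_edges_def)
      then obtain a b where ab: "e' = {a, b}" "a \<noteq> b" "a \<in> verts H'" "b \<in> verts H'"
        by (auto simp: card_2_iff)
      \<comment> \<open>The tensor edge that witnesses the common edge: its projections are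
        \<open>e'\<close> and \<open>e\<close>.\<close>
      define t where "t = {(a, \<pi> a), (b, \<pi> b)}"
      have "t \<in> \<E>" using e e' ab by (simp add: \<E>_def tensor_edges_def t_def)
      moreover have "t \<subseteq> R \<pi>" using ab by (auto simp: t_def R_def)
      ultimately have "t \<subseteq> W \<pi>" by (auto simp: W_def)
      then have "snd ` t \<subseteq> snd ` W \<pi>" by (rule image_mono)
      then have "e \<subseteq> snd ` W \<pi>" using e' ab by (simp add: t_def)
      moreover have "card e = 2" using e V(2) by (auto simp: all_edges_def)
      ultimately show "e \<in> all_edges (snd ` W \<pi>)" by (simp add: all_edges_def)
    qed
    moreover have "finite (W \<pi>)"
      using \<E>N finite_N by (intro finite_subset[of "W \<pi>" "verts H' \<times> verts H"]) (auto simp: W_def)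
    ultimately show "(1 + chi2 p q) ^ card (edges H \<inter> (`) \<pi> ` edges H') \<le> x ^ card (W \<pi>)"
      unfolding x_def using chi by (intro power_card_edges_copy_le[OF \<Gamma> H]) auto
  qed
  also have "\<dots> \<le> fact n * exp (real (card \<E>) * ((x * (2 / real n))\<^sup>2 *
      exp (2 * real ((max_degree \<Gamma>)\<^sup>2) * (x * (2 / real n)))))"
    using covered_moment_le[OF \<E>(1) \<E>N deg x] by (simp add: W_def card_permutations[OF refl])
  also have "\<dots> \<le> fact n * exp (6 * (real (card (edges \<Gamma>)))\<^sup>2 *
        ((x * (2 / real n))\<^sup>2 * exp (2 * real ((max_degree \<Gamma>)\<^sup>2) * (x * (2 / real n)))))"
  proof (intro mult_left_mono, subst exp_le_cancel_iff, rule mult_right_mono)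
    have "real (card \<E>) \<le> real (6 * (card (edges \<Gamma>) * card (edges \<Gamma>)))"
      using \<E>(2) by (rule of_nat_mono)
    then show "real (card \<E>) \<le> 6 * (real (card (edges \<Gamma>)))\<^sup>2"
      by (simp add: power2_eq_square)
  qed auto
  finally show "(\<Sum>\<pi> | \<pi> permutes {1..n}. (1 + chi2 p q) ^ card (edges H \<inter> (`) \<pi> ` edges H'))
      \<le> fact n * exp (6 * (real (card (edges \<Gamma>)))\<^sup>2 *
        ((x * (2 / real n))\<^sup>2 * exp (2 * real ((max_degree \<Gamma>)\<^sup>2) * (x * (2 / real n)))))" .
qed

section \<open>Scan tests\<close>

text \<open>The number of observed edges in \<open>S\<close> is a sum of independent indicators with
  mean \<open>sum w S\<close>, so Hoeffding's inequality applies with unit ranges.\<close>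

lemma random_edges_tail:
  fixes w :: "nat set \<Rightarrow> real"
  assumes S: "S \<subseteq> all_edges {1..n}" "S \<noteq> {}" and w: "\<And>e. 0 \<le> w e \<and> w e \<le> 1" and t: "t \<ge> 0"
  shows "measure_pmf.prob (random_edges n w) {G. real (card (G \<inter> S)) \<ge> sum w S + t}
      \<le> exp (-2 * t\<^sup>2 / real (card S))" (is ?upper)
    and "measure_pmf.prob (random_edges n w) {G. real (card (G \<inter> S)) \<le> sum w S - t}
      \<le> exp (-2 * t\<^sup>2 / real (card S))" (is ?lower)
proof -
  let ?K = "all_edges {1..n}"
  define M where "M = Pi_pmf ?K False (\<lambda>e. bernoulli_pmf (w e))"
  define X :: "nat set \<Rightarrow> (nat set \<Rightarrow> bool) \<Rightarrow> real" where "X e f = of_bool (f e)" for e f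
  have finS: "finite S" using S(1) by (rule finite_subset) simp
  have expect: "measure_pmf.expectation M (X e) = w e" if "e \<in> S" for e
  proof -
    have "measure_pmf.expectation M (X e) = measure_pmf.expectation (map_pmf (\<lambda>f. f e) M) of_bool"
      by (simp add: X_def[abs_def])
    also have "map_pmf (\<lambda>f. f e) M = bernoulli_pmf (w e)"
      unfolding M_def using that S(1) by (subst Pi_pmf_component) auto
    finally show ?thesis using w by simp
  qed
  have indep: "prob_space.indep_vars (measure_pmf M) (\<lambda>_. count_space UNIV) (\<lambda>e f. f e) S"
    unfolding M_def
    by (rule prob_space.indep_vars_subset[OF measure_pmf.prob_space_axioms indep_vars_Pi_pmf S(1)]) simp
  have "prob_space.indep_vars (measure_pmf M) (\<lambda>_. borel) X S"
    unfolding X_def[abs_def]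
    using prob_space.indep_vars_compose2[OF measure_pmf.prob_space_axioms indep, of "\<lambda>_. of_bool" "\<lambda>_. borel"]
    by simp
  then interpret Hoeffding_ineq M S X "\<lambda>_. 0" "\<lambda>_. 1" "\<Sum>e\<in>S. measure_pmf.expectation M (X e)"
    by unfold_locales (auto simp: finS X_def)
  have mean: "(\<Sum>e\<in>S. measure_pmf.expectation M (X e)) = sum w S"
    using expect by simp
  have count: "real (card ({e \<in> ?K. f e} \<inter> S)) = (\<Sum>e\<in>S. X e f)" for f
  proof -
    have "{e \<in> ?K. f e} \<inter> S = S \<inter> {e. f e}" using S(1) by auto
    then show ?thesis using finS by (simp add: X_def sum_of_bool_eq)
  qed
  have law: "random_edges n w = map_pmf (\<lambda>f. {e \<in> ?K. f e}) M"
    by (simp add: random_edges_def M_def)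
  \<comment> \<open>Hoeffding's bound requires a positive sum of squared ranges, hence a nonempty
    \<open>S\<close>.\<close>
  have pos: "(\<Sum>e\<in>S. (1 - 0 :: real)\<^sup>2) > 0" using S(2) finS by (simp add: card_gt_0_iff)
  show ?upper
    using Hoeffding_ineq_ge[OF t pos] by (simp del: One_nat_def add: law vimage_def count mean)
  show ?lower
    using Hoeffding_ineq_le[OF t pos] by (simp del: One_nat_def add: law vimage_def count mean)
qed

text \<open>\<open>q * card S\<close> is the null mean of the count in \<open>S\<close>, so
  \<open>t\<close> is the excess that triggers the alarm.\<close>

definition scan_test :: "nat set set set \<Rightarrow> real \<Rightarrow> real \<Rightarrow> test" where
  "scan_test \<S> q t G = return_pmf (\<exists>S\<in>\<S>. real (card (G \<inter> S)) \<ge> q * real (card S) + t)"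

text \<open>False alarms are controlled by a union bound over the family. For a miss one set
  suffices: given the copy, \<open>hit\<close> provides an \<open>S\<close> whose mean exceeds the
  null mean by at least 2t, so the threshold lies at least t below it. This single tail accounts for
  the \<open>+ 1\<close>.\<close>

lemma risk_scan_test_le:
  assumes q: "0 < q" "q < 1" and p: "q < p" "p \<le> 1" and ne: "copies n \<Gamma> \<noteq> {}"
    and \<S>: "finite \<S>" "\<And>S. S \<in> \<S> \<Longrightarrow> S \<subseteq> all_edges {1..n} \<and> S \<noteq> {} \<and> real (card S) \<le> N"
    and t: "t \<ge> 0"
    and hit: "\<And>H. H \<in> copies n \<Gamma> \<Longrightarrow> \<exists>S\<in>\<S>. 2 * t \<le> (p - q) * real (card (S \<inter> edges H))"
  shows "risk n \<Gamma> p q (scan_test \<S> q t) \<le> (real (card \<S>) + 1) * exp (-2 * t\<^sup>2 / N)"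
proof -
  have tail: "exp (-2 * t\<^sup>2 / real (card S)) \<le> exp (-2 * t\<^sup>2 / N)" if "S \<in> \<S>" for S
  proof -
    have "S \<noteq> {}" "finite S" "real (card S) \<le> N"
      using \<S>(2)[OF that] by (auto intro: finite_subset[OF _ finite_all_edges])
    then have "0 < real (card S)" "real (card S) \<le> N" by (auto simp: card_gt_0_iff)
    then have "2 * t\<^sup>2 / N \<le> 2 * t\<^sup>2 / real (card S)" by (intro divide_left_mono) auto
    then show ?thesis by simp
  qed
  let ?A = "\<lambda>S. {G. real (card (G \<inter> S)) \<ge> q * real (card S) + t}"
  have "measure_pmf.prob (bind_pmf (erdos_renyi n q) (scan_test \<S> q t)) {True}
      = measure_pmf.prob (erdos_renyi n q) (\<Union>S\<in>\<S>. ?A S)"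
  proof -
    have "(\<lambda>G. \<exists>S\<in>\<S>. real (card (G \<inter> S)) \<ge> q * real (card S) + t) -` {True} = (\<Union>S\<in>\<S>. ?A S)"
      by auto
    then show ?thesis
      unfolding scan_test_def[abs_def] map_pmf_def[symmetric] by simp
  qed
  also have "\<dots> \<le> (\<Sum>S\<in>\<S>. measure_pmf.prob (erdos_renyi n q) (?A S))"
    using \<S>(1) by (intro measure_pmf.finite_measure_subadditive_finite) auto
  also have "\<dots> \<le> (\<Sum>S\<in>\<S>. exp (-2 * t\<^sup>2 / N))"
  proof (rule sum_mono)
    fix S assume S: "S \<in> \<S>"
    have "measure_pmf.prob (erdos_renyi n q) (?A S) \<le> exp (-2 * t\<^sup>2 / real (card S))"
      using random_edges_tail(1)[of S n "\<lambda>_. q" t] \<S>(2)[OF S] q t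
      by (simp add: erdos_renyi_def mult.commute)
    then show "measure_pmf.prob (erdos_renyi n q) (?A S) \<le> exp (-2 * t\<^sup>2 / N)"
      using tail[OF S] by (rule order.trans)
  qed
  finally have typeI: "measure_pmf.prob (bind_pmf (erdos_renyi n q) (scan_test \<S> q t)) {True}
      \<le> real (card \<S>) * exp (-2 * t\<^sup>2 / N)" by simp
  have miss: "pmf (bind_pmf (random_edges n (\<lambda>e. if e \<in> edges H then p else q)) (scan_test \<S> q t)) False
      \<le> exp (-2 * t\<^sup>2 / N)" if H: "H \<in> copies n \<Gamma>" for H
  proof -
    let ?w = "\<lambda>e. if e \<in> edges H then p else q"
    obtain S where S: "S \<in> \<S>" "2 * t \<le> (p - q) * real (card (S \<inter> edges H))"
      using hit[OF H] by auto
    have SK: "S \<subseteq> all_edges {1..n}" "S \<noteq> {}" using \<S>(2)[OF S(1)] by auto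
    have finS: "finite S" using SK(1) by (rule finite_subset) simp
    have "sum ?w S = (\<Sum>e\<in>S. q + (if e \<in> edges H then p - q else 0))"
      by (intro sum.cong) auto
    also have "\<dots> = q * real (card S) + (p - q) * real (card (S \<inter> edges H))"
      using finS by (simp add: sum.distrib sum.inter_restrict[symmetric] mult.commute)
    finally have mean: "sum ?w S = q * real (card S) + (p - q) * real (card (S \<inter> edges H))" .
    have "pmf (bind_pmf (random_edges n ?w) (scan_test \<S> q t)) False
        = measure_pmf.prob (random_edges n ?w)
            ((\<lambda>G. \<exists>S\<in>\<S>. real (card (G \<inter> S)) \<ge> q * real (card S) + t) -` {False})"
      unfolding scan_test_def[abs_def] map_pmf_def[symmetric] by (rule pmf_map)
    also have "\<dots> \<le> measure_pmf.prob (random_edges n ?w) {G. real (card (G \<inter> S)) \<le> sum ?w S - t}"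
    proof (intro measure_pmf.finite_measure_mono subsetI CollectI)
      fix G assume "G \<in> (\<lambda>G. \<exists>S\<in>\<S>. real (card (G \<inter> S)) \<ge> q * real (card S) + t) -` {False}"
      then have "\<not> real (card (G \<inter> S)) \<ge> q * real (card S) + t" using S(1) by blast
      then show "real (card (G \<inter> S)) \<le> sum ?w S - t" using S(2) mean by linarith
    qed simp
    also have "\<dots> \<le> exp (-2 * t\<^sup>2 / real (card S))"
      using p q t by (intro random_edges_tail(2) SK) auto
    finally show ?thesis using tail[OF S(1)] by (rule order.trans)
  qed
  have "measure_pmf.prob (bind_pmf (planted n \<Gamma> p q) (scan_test \<S> q t)) {False}
      = (\<Sum>H\<in>copies n \<Gamma>. pmf (bind_pmf (random_edges n (\<lambda>e. if e \<in> edges H then p else q))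
           (scan_test \<S> q t)) False) / card (copies n \<Gamma>)"
    using ne by (simp add: measure_pmf_single planted_def bind_assoc_pmf pmf_bind[of "pmf_of_set _"]
        integral_pmf_of_set)
  also have "\<dots> \<le> (\<Sum>H\<in>copies n \<Gamma>. exp (-2 * t\<^sup>2 / N)) / card (copies n \<Gamma>)"
    using miss by (intro divide_right_mono sum_mono) auto
  also have "\<dots> = exp (-2 * t\<^sup>2 / N)" using ne by simp
  finally show ?thesis using typeI by (simp add: risk_def algebra_simps)
qed

section \<open>The three scan families\<close>

lemma card_all_edges_le: "real (card (all_edges {1..n})) \<le> (real n)\<^sup>2"
proof -
  have "all_edges {1..n} \<subseteq> (\<lambda>(a, b). {a, b}) ` ({1..n} \<times> {1..n})"
    by (auto simp: all_edges_def card_2_iff)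
  then have "card (all_edges {1..n}) \<le> card ({1..n} \<times> {1..n})"
    by (intro surj_card_le) auto
  then have "real (card (all_edges {1..n})) \<le> real (n * n)"
    by (simp only: of_nat_le_iff card_cartesian_product card_atLeastAtMost diff_Suc_1)
  then show ?thesis by (simp add: power2_eq_square)
qed

lemma edge_count_test:
  assumes q: "0 < q" "q < 1" and p: "q < p" "p \<le> 1" and n: "n \<ge> 2"
    and \<Gamma>: "simple_graph \<Gamma>" "card (verts \<Gamma>) \<le> n"
  shows "\<exists>\<phi>. risk n \<Gamma> p q \<phi> \<le> 2 * exp (- ((p - q)\<^sup>2 * (real (card (edges \<Gamma>)))\<^sup>2 / (2 * (real n)\<^sup>2)))"
proof
  \<comment> \<open>Half of the planted shift of the mean, which puts the threshold midway between
    the two means. The other two tests choose \<open>t\<close> in the same way.\<close>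
  let ?t = "(p - q) * real (card (edges \<Gamma>)) / 2"
  have "{1, 2} \<in> all_edges {1..n}" using n by (auto simp: all_edges_def)
  then have "all_edges {1..n} \<noteq> {}" by blast
  moreover have "all_edges {1..n} \<inter> edges H = edges H" if "H \<in> copies n \<Gamma>" for H
    using that by (auto simp: copies_def subgraph_def)
  ultimately have "risk n \<Gamma> p q (scan_test {all_edges {1..n}} q ?t)
      \<le> (real (card {all_edges {1..n}}) + 1) * exp (-2 * ?t\<^sup>2 / (real n)\<^sup>2)"
    using p card_all_edges_le[of n] card_edges_copy[OF \<Gamma>(1)] copies_nonempty[OF \<Gamma>]
    by (intro risk_scan_test_le[OF q p]) (auto simp del: One_nat_def)
  also have "-2 * ?t\<^sup>2 / (real n)\<^sup>2 = - ((p - q)\<^sup>2 * (real (card (edges \<Gamma>)))\<^sup>2 / (2 * (real n)\<^sup>2))"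
    by (simp add: power_divide power_mult_distrib)
  finally show "risk n \<Gamma> p q (scan_test {all_edges {1..n}} q ?t)
      \<le> 2 * exp (- ((p - q)\<^sup>2 * (real (card (edges \<Gamma>)))\<^sup>2 / (2 * (real n)\<^sup>2)))" by simp
qed

text \<open>A copy sends a vertex of maximum degree to some point of [n], and the star there
  contains all its copy edges. There are at most n stars with at most n edges each, which yields the
  factor n + 1 and the exponent of order d_max^2 / n.\<close>

lemma max_degree_test:
  assumes q: "0 < q" "q < 1" and p: "q < p" "p \<le> 1" and n: "n \<ge> 2"
    and \<Gamma>: "simple_graph \<Gamma>" "card (verts \<Gamma>) \<le> n" "verts \<Gamma> \<noteq> {}"
  shows "\<exists>\<phi>. risk n \<Gamma> p q \<phi> \<le> (real n + 1) * exp (- ((p - q)\<^sup>2 * real ((max_degree \<Gamma>)\<^sup>2) / (2 * real n)))"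
proof
  let ?t = "(p - q) * real (max_degree \<Gamma>) / 2"
  define star where "star v = {e \<in> all_edges {1..n}. v \<in> e}" for v
  have star: "star v \<subseteq> all_edges {1..n} \<and> star v \<noteq> {} \<and> real (card (star v)) \<le> real n"
    if "v \<in> {1..n}" for v
  proof -
    have "star v \<subseteq> (\<lambda>u. {v, u}) ` {1..n}"
      by (auto simp: star_def all_edges_def card_2_iff)
    then have "card (star v) \<le> card {1..n}" by (intro surj_card_le) auto
    \<comment> \<open>An explicit edge at \<open>v\<close>, available because n is at least 2;
      nonempty sets are needed for the tail bound.\<close>
    moreover have "(if v = 1 then {1, 2} else {1, v}) \<in> star v"
      using n that by (auto simp: star_def all_edges_def)
    then have "star v \<noteq> {}" by blast
    ultimately show ?thesis by (simp add: star_def)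
  qed
  have hit: "\<exists>S\<in>star ` {1..n}. 2 * ?t \<le> (p - q) * real (card (S \<inter> edges H))"
    if H: "H \<in> copies n \<Gamma>" for H
  proof -
    obtain f where f: "bij_betw f (verts \<Gamma>) (verts H)" "edges H = (`) f ` edges \<Gamma>"
      and V: "verts H \<subseteq> {1..n}" "edges H \<subseteq> all_edges (verts H)"
      using H by (rule copiesE)
    have "max_degree \<Gamma> \<in> degree \<Gamma> ` verts \<Gamma>"
      unfolding max_degree_def using \<Gamma> by (intro Max_in) (auto simp: simple_graph_def)
    then obtain u where u: "u \<in> verts \<Gamma>" "degree \<Gamma> u = max_degree \<Gamma>" by auto
    have "edges H \<subseteq> all_edges {1..n}" using V all_edges_mono by blast
    then have "star (f u) \<inter> edges H = {e \<in> edges H. f u \<in> e}" by (auto simp: star_def)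
    then have "card (star (f u) \<inter> edges H) = max_degree \<Gamma>"
      using degree_image[OF \<Gamma>(1) _ f(2) u(1)] f(1) u(2) by (simp add: bij_betw_def degree_def)
    moreover have "f u \<in> {1..n}" using f(1) u(1) V(1) by (blast dest: bij_betwE)
    ultimately show ?thesis by (intro bexI[of _ "star (f u)"]) auto
  qed
  have starS: "S \<subseteq> all_edges {1..n} \<and> S \<noteq> {} \<and> real (card S) \<le> real n" if "S \<in> star ` {1..n}" for S
    using that star by blast
  have "risk n \<Gamma> p q (scan_test (star ` {1..n}) q ?t)
      \<le> (real (card (star ` {1..n})) + 1) * exp (-2 * ?t\<^sup>2 / real n)"
    using p copies_nonempty[OF \<Gamma>(1,2)] by (intro risk_scan_test_le[OF q p] starS hit) simp_all
  also have "\<dots> \<le> (real n + 1) * exp (-2 * ?t\<^sup>2 / real n)"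
    using card_image_le[of "{1..n}" star] by (intro mult_right_mono) auto
  also have "-2 * ?t\<^sup>2 / real n = - ((p - q)\<^sup>2 * real ((max_degree \<Gamma>)\<^sup>2) / (2 * real n))"
    by (simp add: power_divide power_mult_distrib)
  finally show "risk n \<Gamma> p q (scan_test (star ` {1..n}) q ?t)
      \<le> (real n + 1) * exp (- ((p - q)\<^sup>2 * real ((max_degree \<Gamma>)\<^sup>2) / (2 * real n)))" .
qed

text \<open>Only a densest subgraph \<open>D\<close> is scanned, over its images under all
  injections into [n]. With v vertices there are at most n^v images, each with exactly \<mu> v
  edges, all of them planted in the right image. The size v stays existential because it occurs both
  in the count and in the exponent, and \<open>v \<ge> 1\<close> is enough to compare them.\<close>

lemma densest_subgraph_test:
  assumes q: "0 < q" "q < 1" and p: "q < p" "p \<le> 1"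
    and \<Gamma>: "simple_graph \<Gamma>" "card (verts \<Gamma>) \<le> n" "verts \<Gamma> \<noteq> {}" and pos: "max_density \<Gamma> > 0"
  shows "\<exists>\<phi>. \<exists>v\<ge>1. risk n \<Gamma> p q \<phi> \<le> (real n ^ v + 1) * exp (- ((p - q)\<^sup>2 * (max_density \<Gamma> * real v) / 2))"
proof -
  obtain D where D: "subgraph D \<Gamma>" "verts D \<noteq> {}"
    and dens: "real (card (edges D)) = max_density \<Gamma> * real (card (verts D))"
    using max_density_attained[OF \<Gamma>(1,3)] .
  have fV: "finite (verts D)" and E: "edges D \<subseteq> all_edges (verts D)" "verts D \<subseteq> verts \<Gamma>" "edges D \<subseteq> edges \<Gamma>"
    using D by (auto simp: subgraph_def simple_graph_def)
  have v: "card (verts D) \<ge> 1"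
    using D(2) fV by (simp add: Suc_le_eq card_gt_0_iff)
  have Epos: "real (card (edges D)) > 0" using pos v dens by simp
  let ?t = "(p - q) * real (card (edges D)) / 2"
  \<comment> \<open>Extensional functions: fixing the values outside \<open>verts D\<close> keeps
    the family finite and bounds its size by n^v.\<close>
  define \<F> where "\<F> = {f \<in> verts D \<rightarrow>\<^sub>E {1..n}. inj_on f (verts D)}"
  define im where "im f = (`) f ` edges D" for f :: "nat \<Rightarrow> nat"
  have card_im: "card (im f) = card (edges D)" if "inj_on f (verts D)" for f
  proof -
    have "inj_on ((`) f) (edges D)"
      using D(1) that by (intro inj_on_image_edges) (auto simp: subgraph_def)
    then show ?thesis by (simp add: im_def card_image)
  qed
  have fin: "finite (verts D \<rightarrow>\<^sub>E {1..n})" using fV by (intro finite_PiE) auto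
  have "card \<F> \<le> card (verts D \<rightarrow>\<^sub>E {1..n})"
    using fin by (intro card_mono) (auto simp: \<F>_def)
  also have "\<dots> = n ^ card (verts D)" using fV by (simp add: card_PiE)
  finally have card\<F>: "card \<F> \<le> n ^ card (verts D)" .
  have fin\<F>: "finite \<F>" using fin by (simp add: \<F>_def)
  have im: "im f \<subseteq> all_edges {1..n} \<and> im f \<noteq> {} \<and> real (card (im f)) \<le> real (card (edges D))"
    if f: "f \<in> \<F>" for f
  proof -
    have inj: "inj_on f (verts D)" and sub: "f ` verts D \<subseteq> {1..n}"
      using f by (auto simp: \<F>_def)
    have "im f \<subseteq> all_edges (f ` verts D)"
      unfolding im_def using inj E(1) by (rule image_all_edges_subset)
    also have "\<dots> \<subseteq> all_edges {1..n}" using sub by (rule all_edges_mono)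
    finally show ?thesis using card_im[OF inj] Epos by auto
  qed
  have hit: "\<exists>S\<in>im ` \<F>. 2 * ?t \<le> (p - q) * real (card (S \<inter> edges H))"
    if H: "H \<in> copies n \<Gamma>" for H
  proof -
    obtain f where f: "bij_betw f (verts \<Gamma>) (verts H)" "edges H = (`) f ` edges \<Gamma>"
      and V: "verts H \<subseteq> {1..n}"
      using H by (rule copiesE)
    define g where "g = restrict f (verts D)"
    have ge: "g ` e = f ` e" if "e \<in> edges D" for e
    proof -
      have "e \<subseteq> verts D" using that E(1) by (auto simp: all_edges_def)
      then show ?thesis by (auto simp: g_def subset_eq image_iff)
    qed
    have inj: "inj_on g (verts D)"
      using f(1) E(2) by (auto simp: g_def bij_betw_def inj_on_def)
    have "g \<in> \<F>"
      using inj f(1) E(2) V by (auto simp: \<F>_def g_def bij_betw_def)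
    moreover have "im g \<subseteq> edges H" using ge E(3) by (auto simp: im_def f(2))
    then have "im g \<inter> edges H = im g" by auto
    ultimately show ?thesis using card_im[OF inj] by (intro bexI[of _ "im g"]) auto
  qed
  have "risk n \<Gamma> p q (scan_test (im ` \<F>) q ?t)
      \<le> (real (card (im ` \<F>)) + 1) * exp (-2 * ?t\<^sup>2 / real (card (edges D)))"
    using p im hit fin\<F> copies_nonempty[OF \<Gamma>(1,2)]
    by (intro risk_scan_test_le[OF q p]) (auto simp del: One_nat_def)
  also have "\<dots> \<le> (real n ^ card (verts D) + 1) * exp (-2 * ?t\<^sup>2 / real (card (edges D)))"
  proof (intro mult_right_mono add_right_mono)
    have "card (im ` \<F>) \<le> n ^ card (verts D)"
      using card_image_le[OF fin\<F>, of im] card\<F> by simp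
    then show "real (card (im ` \<F>)) \<le> real n ^ card (verts D)"
      by (metis of_nat_le_iff of_nat_power)
  qed simp
  also have "-2 * ?t\<^sup>2 / real (card (edges D)) = - ((p - q)\<^sup>2 * real (card (edges D)) / 2)"
    using Epos by (simp add: power_divide power_mult_distrib power2_eq_square)
  finally show ?thesis using v unfolding dens by blast
qed

section \<open>Asymptotics\<close>

lemma powr_max_density_le:
  fixes b L \<mu> s :: real
  assumes "1 \<le> b" "b \<le> L" "0 \<le> \<mu>" "\<mu> * ln L \<le> s * ln (real n)" "n > 0"
  shows "b powr \<mu> \<le> real n powr s"
proof -
  have "b powr \<mu> \<le> L powr \<mu>" using assms by (intro powr_mono2) auto
  also have "\<dots> \<le> real n powr s" using assms by (simp add: powr_def)
  finally show ?thesis .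
qed

text \<open>An edge covers two vertices and every vertex is covered. In case (b) this converts the
  bound on edges into the condition that a copy has at most n/2 vertices.\<close>

lemma card_verts_le_edges:
  assumes "simple_graph \<Gamma>" "no_isolated_vertices \<Gamma>"
  shows "card (verts \<Gamma>) \<le> 2 * card (edges \<Gamma>)"
proof -
  have E: "edges \<Gamma> \<subseteq> all_edges (verts \<Gamma>)" "finite (verts \<Gamma>)" using assms by (auto simp: simple_graph_def)
  then have fin: "finite (edges \<Gamma>)" by (auto intro: finite_subset)
  have fe: "finite e \<and> card e = 2" if "e \<in> edges \<Gamma>" for e
  proof -
    have "card e = 2" using E(1) that by (auto simp: all_edges_def)
    then show ?thesis by (simp add: card_ge_0_finite)
  qed
  have "card (verts \<Gamma>) \<le> card (\<Union>e\<in>edges \<Gamma>. e)"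
    using fin fe assms(2) by (intro card_mono finite_UN_I) (auto simp: no_isolated_vertices_def)
  also have "\<dots> \<le> (\<Sum>e\<in>edges \<Gamma>. card e)" using fin by (rule card_UN_le)
  also have "\<dots> = (\<Sum>e\<in>edges \<Gamma>. 2)" using fe by (intro sum.cong) auto
  finally show ?thesis by simp
qed

text \<open>\<open>lo\<close> and \<open>hi\<close> together give k at most n^(C/a), and
  \<open>hi\<close> gives x at most n^(C ln L). The condition on \<open>C\<close> brings the
  exponent of x k^2 / n down to -1/2. It also yields \<open>C / a \<le> 1 / 4\<close>, from which 2k
  \<le> n follows.\<close>

lemma second_moment_le_small_verts:
  assumes q: "0 < q" "q < 1" and p: "0 \<le> p" "p \<le> 1"
    and \<Gamma>: "simple_graph \<Gamma>" "verts \<Gamma> \<noteq> {}"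
    and L: "1 + chi2 p q \<le> L" and a: "a > 0" and C: "C \<ge> 0" "C * ln L + 2 * (C / a) \<le> 1 / 2"
    and lo: "a * ln (real (card (verts \<Gamma>))) \<le> max_density \<Gamma>"
    and hi: "max_density \<Gamma> \<le> C * ln (real n)"
    and n: "n > 0" "2 * real n powr (1 / 4) \<le> real n"
  shows "second_moment n \<Gamma> p q \<le> exp (2 * real n powr (- (1 / 2)))"
proof -
  define k where "k = real (card (verts \<Gamma>))"
  define x where "x = (1 + chi2 p q) powr max_density \<Gamma>"
  have "card (verts \<Gamma>) > 0"
    using \<Gamma> by (simp add: simple_graph_def card_gt_0_iff)
  then have k: "k \<ge> 1" by (simp add: k_def)
  have chi: "chi2 p q \<ge> 0" using q by (simp add: chi2_def)
  have n1: "real n \<ge> 1" using n by simp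
  have lnL: "ln L \<ge> 0" using L chi by simp
  have "a * ln k \<le> C * ln (real n)" using lo hi by (simp add: k_def)
  then have "ln k \<le> C / a * ln (real n)" using a by (simp add: field_simps)
  then have "exp (ln k) \<le> exp (C / a * ln (real n))" by simp
  then have kle: "k \<le> real n powr (C / a)" using k n by (simp add: powr_def)
  have "0 \<le> C * ln L" using C(1) lnL by simp
  then have "C / a \<le> 1 / 4" using C(2) by linarith
  then have "real n powr (C / a) \<le> real n powr (1 / 4)" using n1 by (intro powr_mono) auto
  with kle n have "2 * k \<le> real n" by linarith
  then have kn: "2 * card (verts \<Gamma>) \<le> n" by (simp add: k_def)
  have "max_density \<Gamma> * ln L \<le> C * ln L * ln (real n)"
    using mult_right_mono[OF hi lnL] by (simp add: mult_ac)
  then have xle: "x \<le> real n powr (C * ln L)"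
    unfolding x_def using chi L n max_density_nonneg[OF \<Gamma>] by (intro powr_max_density_le) auto
  have "k\<^sup>2 \<le> (real n powr (C / a))\<^sup>2" using kle k by (intro power_mono) auto
  also have "\<dots> = real n powr (2 * (C / a))" by (simp add: powr_add[symmetric] power2_eq_square)
  finally have "2 * x * k\<^sup>2 / real n \<le> 2 * real n powr (C * ln L) * real n powr (2 * (C / a)) / real n"
    using xle n by (intro divide_right_mono mult_mono) (auto simp: x_def)
  also have "\<dots> = 2 * real n powr (C * ln L + 2 * (C / a) - 1)"
    using n by (simp add: powr_add powr_diff)
  also have "\<dots> \<le> 2 * real n powr (- (1 / 2))"
    using C(2) n1 by (intro mult_left_mono powr_mono) auto
  finally have "exp (2 * x * k\<^sup>2 / real n) \<le> exp (2 * real n powr (- (1 / 2)))" by simp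
  with second_moment_le_vertices[OF q p \<Gamma> kn] show ?thesis
    by (simp only: x_def k_def)
qed

text \<open>With x at most n^(\<epsilon>/4), the degree term d_max^2 x / n is at most
  n^(-3\<epsilon>/4) up to a constant, so its exponential stays below \<open>exp 4\<close>. The edge
  term |e|^2 x^2 / n^2 is at most n^(-3\<epsilon>/2). The 24 is 6 from the tensor edges times the
  square of the 2 in 2/n.\<close>

lemma second_moment_le_few_edges:
  assumes q: "0 < q" "q < 1" and p: "0 \<le> p" "p \<le> 1"
    and \<Gamma>: "simple_graph \<Gamma>" "verts \<Gamma> \<noteq> {}" "no_isolated_vertices \<Gamma>"
    and L: "1 + chi2 p q \<le> L" and \<epsilon>: "\<epsilon> > 0"
    and hi: "max_density \<Gamma> * ln L \<le> \<epsilon> / 4 * ln (real n)"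
    and e: "real (card (edges \<Gamma>)) \<le> real n powr (1 - \<epsilon>)"
    and d: "real ((max_degree \<Gamma>)\<^sup>2) \<le> real n powr (1 - \<epsilon>)"
    and n: "n > 0" "4 * real n powr (1 - \<epsilon>) \<le> real n"
  shows "second_moment n \<Gamma> p q \<le> exp (24 * exp 4 * real n powr (- (3 / 2 * \<epsilon>)))"
proof -
  define x where "x = (1 + chi2 p q) powr max_density \<Gamma>"
  define m where "m = real (card (edges \<Gamma>))"
  define D where "D = real ((max_degree \<Gamma>)\<^sup>2)"
  have chi: "chi2 p q \<ge> 0" using q by (simp add: chi2_def)
  have n1: "real n \<ge> 1" using n by simp
  have "real (card (verts \<Gamma>)) \<le> 2 * real (card (edges \<Gamma>))"
    using card_verts_le_edges[OF \<Gamma>(1,3)] by simp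
  then have kn: "2 * card (verts \<Gamma>) \<le> n" using e n by linarith
  have xle: "x \<le> real n powr (\<epsilon> / 4)"
    unfolding x_def using chi L n hi max_density_nonneg[OF \<Gamma>(1,2)]
    by (intro powr_max_density_le) auto
  have x0: "x \<ge> 0" by (simp add: x_def)
  have y: "x * (2 / real n) \<le> 2 * real n powr (\<epsilon> / 4 - 1)"
    using xle n by (simp add: powr_diff divide_right_mono)
  have "2 * D * (x * (2 / real n)) \<le> 2 * real n powr (1 - \<epsilon>) * (2 * real n powr (\<epsilon> / 4 - 1))"
    using d x0 by (intro mult_mono[OF _ y]) (auto simp: D_def)
  also have "\<dots> = 4 * real n powr (- (3 / 4 * \<epsilon>))"
    using n by (simp add: powr_add[symmetric])
  also have "\<dots> \<le> 4 * real n powr 0"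
    using n1 \<epsilon> by (intro mult_left_mono powr_mono) auto
  finally have small: "2 * D * (x * (2 / real n)) \<le> 4" using n by simp
  have "(x * (2 / real n))\<^sup>2 \<le> (2 * real n powr (\<epsilon> / 4 - 1))\<^sup>2"
    using y x0 by (intro power_mono) auto
  moreover have "m\<^sup>2 \<le> (real n powr (1 - \<epsilon>))\<^sup>2"
    using e by (intro power_mono) (auto simp: m_def)
  ultimately have "6 * m\<^sup>2 * ((x * (2 / real n))\<^sup>2 * exp (2 * D * (x * (2 / real n))))
      \<le> 6 * (real n powr (1 - \<epsilon>))\<^sup>2 * ((2 * real n powr (\<epsilon> / 4 - 1))\<^sup>2 * exp 4)"
    using small by (intro mult_mono) auto
  also have "\<dots> = 24 * exp 4 * ((real n powr (1 - \<epsilon>))\<^sup>2 * (real n powr (\<epsilon> / 4 - 1))\<^sup>2)"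
    by (simp add: power_mult_distrib)
  also have "(real n powr (1 - \<epsilon>))\<^sup>2 * (real n powr (\<epsilon> / 4 - 1))\<^sup>2 = real n powr (- (3 / 2 * \<epsilon>))"
    by (simp add: powr_add[symmetric] power2_eq_square)
  finally have "exp (6 * m\<^sup>2 * ((x * (2 / real n))\<^sup>2 * exp (2 * D * (x * (2 / real n)))))
      \<le> exp (24 * exp 4 * real n powr (- (3 / 2 * \<epsilon>)))" by simp
  with second_moment_le_edges[OF q p \<Gamma>(1,2) kn] show ?thesis
    by (simp only: x_def m_def D_def)
qed

text \<open>The sum of three error bounds serves whichever alternative holds at this n. The constant
  \<open>4 / \<delta>\<^sup>2\<close> makes the Hoeffding exponent of the densest-subgraph test at
  least 2 v ln n, so n^(-2v) outweighs the n^v sets.\<close>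

lemma good_test_exists:
  assumes q: "0 < q" "q < 1" and p: "q < p" "p \<le> 1" and n: "n \<ge> 2"
    and \<Gamma>: "simple_graph \<Gamma>" "card (verts \<Gamma>) \<le> n" "verts \<Gamma> \<noteq> {}"
    and \<delta>: "\<delta> > 0" "\<delta> \<le> p - q"
    and big: "max_density \<Gamma> \<ge> 4 / \<delta>\<^sup>2 * ln (real n) \<or> real (card (edges \<Gamma>)) \<ge> real n powr (1 + \<epsilon>)
      \<or> real ((max_degree \<Gamma>)\<^sup>2) \<ge> real n powr (1 + \<epsilon>)"
  shows "\<exists>\<phi>. risk n \<Gamma> p q \<phi> \<le> 2 / real n + 2 * exp (- (\<delta>\<^sup>2 / 2 * real n powr (2 * \<epsilon>)))
      + (real n + 1) * exp (- (\<delta>\<^sup>2 / 2 * real n powr \<epsilon>))"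
proof -
  have n0: "real n \<ge> 2" using n by simp
  have \<delta>2: "\<delta>\<^sup>2 \<le> (p - q)\<^sup>2" using \<delta> by (intro power_mono) auto
  have pos: "0 \<le> 2 / real n" "0 \<le> 2 * exp (- (\<delta>\<^sup>2 / 2 * real n powr (2 * \<epsilon>)))"
    "0 \<le> (real n + 1) * exp (- (\<delta>\<^sup>2 / 2 * real n powr \<epsilon>))" by auto
  consider "max_density \<Gamma> \<ge> 4 / \<delta>\<^sup>2 * ln (real n)" | "real (card (edges \<Gamma>)) \<ge> real n powr (1 + \<epsilon>)"
    | "real ((max_degree \<Gamma>)\<^sup>2) \<ge> real n powr (1 + \<epsilon>)" using big by auto
  then show ?thesis
  proof cases
    case 1
    have "4 / \<delta>\<^sup>2 * ln (real n) > 0" using \<delta> n0 by simp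
    then have mpos: "max_density \<Gamma> > 0" using 1 by linarith
    then obtain \<phi> v where v: "v \<ge> 1" and
      risk: "risk n \<Gamma> p q \<phi> \<le> (real n ^ v + 1) * exp (- ((p - q)\<^sup>2 * (max_density \<Gamma> * real v) / 2))"
      using densest_subgraph_test[OF q p \<Gamma>] by blast
    define y where "y = real n ^ v"
    have "real n ^ 1 \<le> y" unfolding y_def using v n0 by (intro power_increasing) auto
    then have y: "real n \<le> y" "1 \<le> y" using n0 by auto
    have "\<delta>\<^sup>2 * (4 / \<delta>\<^sup>2 * ln (real n) * real v) \<le> (p - q)\<^sup>2 * (max_density \<Gamma> * real v)"
      using \<delta>2 1 n0 mpos by (intro mult_mono) auto
    moreover have "\<delta>\<^sup>2 * (4 / \<delta>\<^sup>2 * ln (real n) * real v) = 4 * (real v * ln (real n))"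
      using \<delta> by simp
    ultimately have "exp (- ((p - q)\<^sup>2 * (max_density \<Gamma> * real v) / 2)) \<le> exp (- (2 * (real v * ln (real n))))"
      by simp
    also have "\<dots> = 1 / y\<^sup>2"
    proof -
      have "exp (real v * ln (real n)) = y"
        using n0 by (simp add: y_def exp_of_nat_mult)
      then have "exp (2 * (real v * ln (real n))) = y\<^sup>2"
        using exp_of_nat_mult[of 2 "real v * ln (real n)"] by simp
      then show ?thesis by (simp add: exp_minus inverse_eq_divide)
    qed
    finally have "(y + 1) * exp (- ((p - q)\<^sup>2 * (max_density \<Gamma> * real v) / 2)) \<le> (y + 1) * (1 / y\<^sup>2)"
      using y by (intro mult_left_mono) auto
    also have "\<dots> \<le> (2 * y) * (1 / y\<^sup>2)" using y by (intro mult_right_mono) auto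
    also have "\<dots> = 2 / y" by (simp add: power2_eq_square)
    also have "\<dots> \<le> 2 / real n" using y n0 by (intro divide_left_mono) auto
    finally have "risk n \<Gamma> p q \<phi> \<le> 2 / real n" using risk by (simp add: y_def)
    then show ?thesis using pos by (intro exI[of _ \<phi>]) linarith
  next
    case 2
    obtain \<phi> where
      risk: "risk n \<Gamma> p q \<phi> \<le> 2 * exp (- ((p - q)\<^sup>2 * (real (card (edges \<Gamma>)))\<^sup>2 / (2 * (real n)\<^sup>2)))"
      using edge_count_test[OF q p n \<Gamma>(1,2)] by blast
    have "\<delta>\<^sup>2 * (real n powr (1 + \<epsilon>))\<^sup>2 \<le> (p - q)\<^sup>2 * (real (card (edges \<Gamma>)))\<^sup>2"
      using \<delta>2 2 by (intro mult_mono[OF \<delta>2] power_mono) auto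
    then have "\<delta>\<^sup>2 * (real n powr (1 + \<epsilon>))\<^sup>2 / (2 * (real n)\<^sup>2)
        \<le> (p - q)\<^sup>2 * (real (card (edges \<Gamma>)))\<^sup>2 / (2 * (real n)\<^sup>2)"
      by (intro divide_right_mono) auto
    moreover have "(real n powr (1 + \<epsilon>))\<^sup>2 = (real n)\<^sup>2 * real n powr (2 * \<epsilon>)"
      using n0 by (simp add: powr_add power_mult_distrib) (simp add: power2_eq_square powr_add[symmetric])
    ultimately have "\<delta>\<^sup>2 / 2 * real n powr (2 * \<epsilon>) \<le> (p - q)\<^sup>2 * (real (card (edges \<Gamma>)))\<^sup>2 / (2 * (real n)\<^sup>2)"
      using n0 by simp
    then have "2 * exp (- ((p - q)\<^sup>2 * (real (card (edges \<Gamma>)))\<^sup>2 / (2 * (real n)\<^sup>2)))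
        \<le> 2 * exp (- (\<delta>\<^sup>2 / 2 * real n powr (2 * \<epsilon>)))"
      by simp
    then show ?thesis using pos risk by (intro exI[of _ \<phi>]) linarith
  next
    case 3
    obtain \<phi> where
      risk: "risk n \<Gamma> p q \<phi> \<le> (real n + 1) * exp (- ((p - q)\<^sup>2 * real ((max_degree \<Gamma>)\<^sup>2) / (2 * real n)))"
      using max_degree_test[OF q p n \<Gamma>] by blast
    have "\<delta>\<^sup>2 * real n powr (1 + \<epsilon>) \<le> (p - q)\<^sup>2 * real ((max_degree \<Gamma>)\<^sup>2)"
      using \<delta>2 3 by (intro mult_mono) auto
    then have "\<delta>\<^sup>2 * real n powr (1 + \<epsilon>) / (2 * real n) \<le> (p - q)\<^sup>2 * real ((max_degree \<Gamma>)\<^sup>2) / (2 * real n)"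
      by (intro divide_right_mono) auto
    moreover have "real n powr (1 + \<epsilon>) = real n * real n powr \<epsilon>"
      using n0 by (simp add: powr_add)
    ultimately have "\<delta>\<^sup>2 / 2 * real n powr \<epsilon> \<le> (p - q)\<^sup>2 * real ((max_degree \<Gamma>)\<^sup>2) / (2 * real n)"
      using n0 by simp
    then have "(real n + 1) * exp (- ((p - q)\<^sup>2 * real ((max_degree \<Gamma>)\<^sup>2) / (2 * real n)))
        \<le> (real n + 1) * exp (- (\<delta>\<^sup>2 / 2 * real n powr \<epsilon>))"
      by (intro mult_left_mono) auto
    then show ?thesis using pos risk by (intro exI[of _ \<phi>]) linarith
  qed
qed

text \<open>A test is chosen separately for each n, so the type of scan may change along the
  sequence.\<close>

lemma strong_detection_possibleI:
  assumes ex: "\<forall>\<^sub>F n in sequentially. \<exists>\<phi>. risk n (\<Gamma> n) (p n) (q n) \<phi> \<le> b n" and b: "b \<longlonglongrightarrow> 0"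
  shows "strong_detection_possible \<Gamma> p q"
proof -
  define \<phi> where "\<phi> n = (SOME \<phi>. risk n (\<Gamma> n) (p n) (q n) \<phi> \<le> b n)" for n
  have le: "\<forall>\<^sub>F n in sequentially. risk n (\<Gamma> n) (p n) (q n) (\<phi> n) \<le> b n"
    using ex unfolding \<phi>_def by (rule eventually_mono) (erule someI_ex)
  have "(\<lambda>n. risk n (\<Gamma> n) (p n) (q n) (\<phi> n)) \<longlonglongrightarrow> 0"
    by (rule tendsto_sandwich[OF _ le tendsto_const b]) (simp add: risk_def)
  then have "(\<lambda>n. ereal (risk n (\<Gamma> n) (p n) (q n) (\<phi> n))) \<longlonglongrightarrow> ereal 0"
    by (intro tendsto_intros)
  then have "limsup (\<lambda>n. ereal (risk n (\<Gamma> n) (p n) (q n) (\<phi> n))) = ereal 0"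
    by (rule lim_imp_Limsup[OF sequentially_bot])
  then show ?thesis unfolding strong_detection_possible_def zero_ereal_def by blast
qed

theorem theorem1:
  fixes p q :: "nat \<Rightarrow> real"
  assumes pq: "\<forall>n\<ge>2. 0 < q n \<and> q n < 1 \<and> q n < p n \<and> p n \<le> 1"
    and chi2_Theta: "(\<lambda>n. chi2 (p n) (q n)) \<in> \<Theta>(\<lambda>_. 1)"
    and gap: "\<exists>\<delta>\<^sub>0>0. \<forall>n\<ge>2. \<delta>\<^sub>0 < p n - q n \<and> p n - q n < 1 - \<delta>\<^sub>0"
  shows
    "(\<forall>\<alpha> :: nat \<Rightarrow> real.
        (\<forall>\<^sub>F n in sequentially. \<alpha> n > 0) \<longrightarrow> \<alpha> \<in> \<Omega>(\<lambda>_. 1) \<longrightarrow>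
        (\<exists>C>0. \<forall>\<Gamma>. planted_sequence \<Gamma> \<longrightarrow>
           (\<forall>\<^sub>F n in sequentially.
              max_density (\<Gamma> n) \<ge> \<alpha> n * ln (real (card (verts (\<Gamma> n))))) \<longrightarrow>
           (\<forall>\<^sub>F n in sequentially. max_density (\<Gamma> n) \<le> C * ln (real n)) \<longrightarrow>
           weak_detection_impossible \<Gamma> p q))
     \<and> (\<forall>\<Gamma>. planted_sequence \<Gamma> \<longrightarrow>
          (\<lambda>n. max_density (\<Gamma> n)) \<in> o(\<lambda>n. ln (real (card (verts (\<Gamma> n))))) \<longrightarrow>
          (\<forall>\<epsilon>>0.
             (\<forall>\<^sub>F n in sequentially.
                real (max (card (edges (\<Gamma> n))) ((max_degree (\<Gamma> n))\<^sup>2))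
                  \<le> real n powr (1 - \<epsilon>)) \<longrightarrow>
             weak_detection_impossible \<Gamma> p q))
     \<and> (\<exists>C>0. \<forall>\<epsilon>>0. \<forall>\<Gamma>. planted_sequence \<Gamma> \<longrightarrow>
          (\<forall>\<^sub>F n in sequentially.
             max_density (\<Gamma> n) \<ge> C * ln (real n)
             \<or> real (card (edges (\<Gamma> n))) \<ge> real n powr (1 + \<epsilon>)
             \<or> real ((max_degree (\<Gamma> n))\<^sup>2) \<ge> real n powr (1 + \<epsilon>)) \<longrightarrow>
          strong_detection_possible \<Gamma> p q)"
proof -
  from bigthetaD1[OF chi2_Theta] obtain c where c: "c > 0"
    "\<forall>\<^sub>F n in sequentially. norm (chi2 (p n) (q n)) \<le> c * norm (1 :: real)"
    by (rule landau_o.bigE)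
  \<comment> \<open>A uniform bound on 1 + chi-squared for large n, strictly above 1 so that
    \<open>ln L\<close> can be divided by.\<close>
  define L where "L = 1 + c"
  have L: "\<forall>\<^sub>F n in sequentially. 1 + chi2 (p n) (q n) \<le> L"
    using c(2) by eventually_elim (simp add: L_def)
  have lnL: "ln L > 0" using c(1) by (simp add: L_def)
  have ge2: "\<forall>\<^sub>F n :: nat in sequentially. n \<ge> 2" by (rule eventually_ge_at_top)
  have \<Gamma>D: "simple_graph (\<Gamma> n)" "verts (\<Gamma> n) \<noteq> {}" "no_isolated_vertices (\<Gamma> n)" "card (verts (\<Gamma> n)) \<le> n"
    if "planted_sequence \<Gamma>" "n \<ge> 2" for \<Gamma> n
    using that by (auto simp: planted_sequence_def)
  have qn: "0 < q n" "q n < 1" "0 \<le> p n" "p n \<le> 1" "q n < p n" if "n \<ge> 2" for n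
    using pq that by force+
  show ?thesis
  proof (intro conjI allI impI)
    fix \<alpha> :: "nat \<Rightarrow> real"
    assume \<alpha>_pos: "\<forall>\<^sub>F n in sequentially. \<alpha> n > 0" and "\<alpha> \<in> \<Omega>(\<lambda>_. 1)"
    then obtain a where a: "a > 0" "\<forall>\<^sub>F n in sequentially. norm (\<alpha> n) \<ge> a * norm (1 :: real)"
      by (elim landau_omega.bigE)
    \<comment> \<open>Chosen so that C ln L + 2C/a = 1/4. It depends only on p, q and \<alpha>, as
      it must be fixed before \<Gamma>.\<close>
    define C where "C = 1 / (4 * (ln L + 2 / a))"
    have den: "ln L + 2 / a > 0" using lnL a(1) by (intro add_pos_pos) auto
    have C: "C > 0" "C * ln L + 2 * (C / a) \<le> 1 / 2"
    proof -
      show "C > 0" using den by (simp add: C_def)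
      have "C * ln L + 2 * (C / a) = C * (ln L + 2 / a)" by (simp add: algebra_simps)
      also have "\<dots> = 1 / 4" using den by (simp add: C_def)
      finally show "C * ln L + 2 * (C / a) \<le> 1 / 2" by simp
    qed
    have large: "\<forall>\<^sub>F n :: nat in sequentially. 2 * real n powr (1 / 4) \<le> real n" by real_asymp
    have lim: "(\<lambda>n. 2 * real n powr (- (1 / 2))) \<longlonglongrightarrow> 0" by real_asymp
    have "weak_detection_impossible \<Gamma> p q"
      if \<Gamma>: "planted_sequence \<Gamma>"
        and lo: "\<forall>\<^sub>F n in sequentially. max_density (\<Gamma> n) \<ge> \<alpha> n * ln (real (card (verts (\<Gamma> n))))"
        and hi: "\<forall>\<^sub>F n in sequentially. max_density (\<Gamma> n) \<le> C * ln (real n)" for \<Gamma>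
    proof (rule weak_detection_impossibleI[OF pq \<Gamma> _ lim])
      show "\<forall>\<^sub>F n in sequentially. second_moment n (\<Gamma> n) (p n) (q n) \<le> exp (2 * real n powr (- (1 / 2)))"
        using L lo hi ge2 large a(2) \<alpha>_pos
      proof eventually_elim
        case (elim n)
        have "card (verts (\<Gamma> n)) > 0"
          using \<Gamma>D[OF \<Gamma> elim(4)] by (simp add: simple_graph_def card_gt_0_iff)
        \<comment> \<open>Positivity of \<open>\<alpha> n\<close> removes the norm from its lower
          bound, and the logarithm is nonnegative because there is at least one vertex.\<close>
        then have "a * ln (real (card (verts (\<Gamma> n)))) \<le> \<alpha> n * ln (real (card (verts (\<Gamma> n))))"
          using elim(6,7) by (intro mult_right_mono) (auto simp: Suc_le_eq)
        then have "a * ln (real (card (verts (\<Gamma> n)))) \<le> max_density (\<Gamma> n)"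
          using elim(2) by linarith
        then show ?case
          using elim qn[OF elim(4)] \<Gamma>D[OF \<Gamma> elim(4)] a(1) C
          by (intro second_moment_le_small_verts[of "q n" "p n" "\<Gamma> n" L a C n]) auto
      qed
    qed
    then show "\<exists>C>0. \<forall>\<Gamma>. planted_sequence \<Gamma> \<longrightarrow>
           (\<forall>\<^sub>F n in sequentially. max_density (\<Gamma> n) \<ge> \<alpha> n * ln (real (card (verts (\<Gamma> n))))) \<longrightarrow>
           (\<forall>\<^sub>F n in sequentially. max_density (\<Gamma> n) \<le> C * ln (real n)) \<longrightarrow>
           weak_detection_impossible \<Gamma> p q"
      using C(1) by blast
  next
    fix \<Gamma> :: "nat \<Rightarrow> ugraph" and \<epsilon> :: real
    assume \<Gamma>: "planted_sequence \<Gamma>" and \<epsilon>: "\<epsilon> > 0"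
      and small_o: "(\<lambda>n. max_density (\<Gamma> n)) \<in> o(\<lambda>n. ln (real (card (verts (\<Gamma> n)))))"
      and few: "\<forall>\<^sub>F n in sequentially. real (max (card (edges (\<Gamma> n))) ((max_degree (\<Gamma> n))\<^sup>2))
                  \<le> real n powr (1 - \<epsilon>)"
    \<comment> \<open>This fraction of log k, with k at most n, makes \<mu> ln L at most
      (\<epsilon>/4) ln n, hence x at most n^(\<epsilon>/4).\<close>
    define \<eta> where "\<eta> = \<epsilon> / (4 * ln L)"
    have \<eta>: "\<eta> > 0" "\<eta> * ln L = \<epsilon> / 4" using \<epsilon> lnL by (auto simp: \<eta>_def)
    have dens: "\<forall>\<^sub>F n in sequentially.
        norm (max_density (\<Gamma> n)) \<le> \<eta> * norm (ln (real (card (verts (\<Gamma> n)))))"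
      using small_o \<eta>(1) by (rule landau_o.smallD)
    have large: "\<forall>\<^sub>F n :: nat in sequentially. 4 * real n powr (1 - \<epsilon>) \<le> real n"
      using \<epsilon> by real_asymp
    have lim: "(\<lambda>n. 24 * exp 4 * real n powr (- (3 / 2 * \<epsilon>))) \<longlonglongrightarrow> 0"
      using \<epsilon> by real_asymp
    show "weak_detection_impossible \<Gamma> p q"
    proof (rule weak_detection_impossibleI[OF pq \<Gamma> _ lim])
      show "\<forall>\<^sub>F n in sequentially. second_moment n (\<Gamma> n) (p n) (q n)
          \<le> exp (24 * exp 4 * real n powr (- (3 / 2 * \<epsilon>)))"
        using L few ge2 large dens
      proof eventually_elim
        case (elim n)
        have k: "card (verts (\<Gamma> n)) > 0"
          using \<Gamma>D[OF \<Gamma> elim(3)] by (simp add: simple_graph_def card_gt_0_iff)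
        then have "max_density (\<Gamma> n) \<le> \<eta> * ln (real (card (verts (\<Gamma> n))))"
          using elim(5) by (simp add: Suc_le_eq)
        also have "\<dots> \<le> \<eta> * ln (real n)"
          using \<Gamma>D(4)[OF \<Gamma> elim(3)] k \<eta>(1) by (intro mult_left_mono) auto
        finally have "max_density (\<Gamma> n) * ln L \<le> \<eta> * ln (real n) * ln L"
          using lnL by (intro mult_right_mono) auto
        also have "\<dots> = \<eta> * ln L * ln (real n)" by simp
        also have "\<dots> = \<epsilon> / 4 * ln (real n)" by (simp only: \<eta>(2))
        finally have dens: "max_density (\<Gamma> n) * ln L \<le> \<epsilon> / 4 * ln (real n)" .
        have "real (card (edges (\<Gamma> n))) \<le> real n powr (1 - \<epsilon>)"
          "real ((max_degree (\<Gamma> n))\<^sup>2) \<le> real n powr (1 - \<epsilon>)"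
          using elim(2) by (simp_all add: of_nat_max del: of_nat_power)
        then show ?case
          using dens elim qn[OF elim(3)] \<Gamma>D[OF \<Gamma> elim(3)] \<epsilon>
          by (intro second_moment_le_few_edges[of "q n" "p n" "\<Gamma> n" L \<epsilon> n]) auto
      qed
    qed
  next
    \<comment> \<open>The uniform gap fixes the constant \<open>4 / \<delta>\<^sup>2\<close> before
      \<epsilon> and \<Gamma> are given.\<close>
    obtain \<delta> where \<delta>: "\<delta> > 0" "\<And>n. n \<ge> 2 \<Longrightarrow> \<delta> \<le> p n - q n"
      using gap by (meson less_imp_le)
    have "strong_detection_possible \<Gamma> p q"
      if \<epsilon>: "\<epsilon> > 0" and \<Gamma>: "planted_sequence \<Gamma>" and big: "\<forall>\<^sub>F n in sequentially.
             max_density (\<Gamma> n) \<ge> 4 / \<delta>\<^sup>2 * ln (real n)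
             \<or> real (card (edges (\<Gamma> n))) \<ge> real n powr (1 + \<epsilon>)
             \<or> real ((max_degree (\<Gamma> n))\<^sup>2) \<ge> real n powr (1 + \<epsilon>)" for \<epsilon> \<Gamma>
    proof (rule strong_detection_possibleI)
      show "\<forall>\<^sub>F n in sequentially. \<exists>\<phi>. risk n (\<Gamma> n) (p n) (q n) \<phi>
          \<le> 2 / real n + 2 * exp (- (\<delta>\<^sup>2 / 2 * real n powr (2 * \<epsilon>)))
            + (real n + 1) * exp (- (\<delta>\<^sup>2 / 2 * real n powr \<epsilon>))"
        using big ge2
      proof eventually_elim
        case (elim n)
        then show ?case
          using qn[OF elim(2)] \<Gamma>D[OF \<Gamma> elim(2)] \<delta>
          by (intro good_test_exists) auto
      qed
      have "\<delta>\<^sup>2 / 2 > 0" using \<delta>(1) by simp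
      then show "(\<lambda>n. 2 / real n + 2 * exp (- (\<delta>\<^sup>2 / 2 * real n powr (2 * \<epsilon>)))
            + (real n + 1) * exp (- (\<delta>\<^sup>2 / 2 * real n powr \<epsilon>))) \<longlonglongrightarrow> 0"
        using \<epsilon> by real_asymp
    qed
    moreover have "4 / \<delta>\<^sup>2 > 0" using \<delta>(1) by simp
    ultimately show "\<exists>C>0. \<forall>\<epsilon>>0. \<forall>\<Gamma>. planted_sequence \<Gamma> \<longrightarrow>
          (\<forall>\<^sub>F n in sequentially.
             max_density (\<Gamma> n) \<ge> C * ln (real n)
             \<or> real (card (edges (\<Gamma> n))) \<ge> real n powr (1 + \<epsilon>)
             \<or> real ((max_degree (\<Gamma> n))\<^sup>2) \<ge> real n powr (1 + \<epsilon>)) \<longrightarrow>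
          strong_detection_possible \<Gamma> p q"
      by blast
  qed
qed

end
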